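(* Let $R$ be a consistent triple set. If $R'\subseteq R$ satisfies $\mathrm{cl}(R')=\mathrm{cl}(R)$, then $\mathfrak L^*(R;R)=\mathfrak L^*(R';R')$. In particular, for every $ab|c\in\mathrm{cl}(R)$ and every such $R'$ we have $\mathfrak L^*(ab|c;R')=\mathfrak L^*(ab|c;R)$.
   Context: A rooted tree $T$ has a distinguished inner vertex (root); leaves are degree-1 vertices; inner vertices other than the root have degree at least 3. A triple $ab|c$ is the rooted binary tree on leaves $a,b,c$ where the path from $a$ to $b$ avoids the path from $c$ to the root; $ab|c=ba|c$. A rooted tree displays $ab|c$ if $a,b,c$ are leaves and the path from $a$ to $b$ does not intersect the path from $c$ to the root; $\mathcal R(T)$ is the set of displayed triples. A triple set is consistent if some rooted tree displays all its triples. $L_S$ is the set of leaves appearing in a triple set $S$. $\mathrm{cl}(S)=\bigcap\mathcal R(T)$ over all rooted trees $T$ with leaf set $L_S$ displaying $S$. For $\mathcal L\subseteq L_S$, the Ahograph $[S,\mathcal L]$ has vertex set $\mathcal L$, distinct $x,y\in\mathcal L$ adjacent iff some $xy|z\in S$ has $z\in\mathcal L$; connected components are identified with vertex sets. For $a,b,c$, $\mathfrak L(ab|c;S)$ is the set of unordered pairs $\{A,B\}$, $A,B\subseteq L_S$, such that $[S,A\cup B]$ has exactly two connected components $A$ and $B$, one containing $a,b$ and the other $c$. For consistent $S$ and $ab|c\in\mathrm{cl}(S)$ this set has a unique element maximizing $|A\cup B|$, denoted $\mathfrak L^*(ab|c;S)$; and $\mathfrak L^*(S;S)=\{\mathfrak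 L^*(r;S):r\in S\}$. *)

theory Defs
  imports "Graph_Theory.Pair_Digraph" "Graph_Theory.Digraph_Component"
begin

text \<open>
  Undirected finite simple graphs are \<^const>\<open>pair_graph\<close>s, i.e. finite, loop-free, symmetric
  digraphs.  The library constant \<^const>\<open>Digraph_Component.tree\<close> is unsuitable here: it counts the walk u, v, u
  along a single undirected edge as a cycle, hence the length bound below.
\<close>

definition undirected_tree :: "'v pair_pre_digraph \<Rightarrow> bool" where
  "undirected_tree T \<longleftrightarrow> pair_graph T \<and> Digraph_Component.connected (with_proj T) \<and>
     \<not> (\<exists>p. pre_digraph.cycle (with_proj T) p \<and> 3 \<le> length p)"

text \<open>In a symmetric digraph the undirected degree is the out-degree.\<close>

definition leaves :: "'v pair_pre_digraph \<Rightarrow> 'v set" where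
  "leaves T = {v \<in> pverts T. out_degree (with_proj T) v = 1}"

definition inner_vertices :: "'v pair_pre_digraph \<Rightarrow> 'v set" where
  "inner_vertices T = pverts T - leaves T"

text \<open>The one-vertex tree is admitted; it is the only rooted tree with empty leaf set.\<close>

definition rooted_tree :: "'v pair_pre_digraph \<Rightarrow> 'v \<Rightarrow> bool" where
  "rooted_tree T r \<longleftrightarrow> undirected_tree T \<and> r \<in> inner_vertices T \<and>
     (\<forall>v \<in> inner_vertices T - {r}. 3 \<le> out_degree (with_proj T) v)"

text \<open>
  The tree T with root r displays the triple ab|c.  Paths in a tree are unique, so
  quantifying over all of them is harmless.
\<close>

definition displays :: "'v pair_pre_digraph \<Rightarrow> 'v \<Rightarrow> 'v \<Rightarrow> 'v \<Rightarrow> 'v \<Rightarrow> bool" where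
  "displays T r a b c \<longleftrightarrow> a \<in> leaves T \<and> b \<in> leaves T \<and> c \<in> leaves T \<and> distinct [a, b, c] \<and>
     (\<forall>p q. pre_digraph.apath (with_proj T) a p b \<longrightarrow> pre_digraph.apath (with_proj T) c q r \<longrightarrow>
        set (pre_digraph.awalk_verts (with_proj T) a p) \<inter>
        set (pre_digraph.awalk_verts (with_proj T) c q) = {})"

text \<open>The triple ab|c is encoded so that ab|c = ba|c holds by construction.\<close>

type_synonym 'a triple = "'a set \<times> 'a"

abbreviation triple :: "'a \<Rightarrow> 'a \<Rightarrow> 'a \<Rightarrow> 'a triple" where
  "triple a b c \<equiv> ({a, b}, c)"

definition triple_set :: "'a triple set \<Rightarrow> bool" where
  "triple_set S \<longleftrightarrow> S \<subseteq> {triple a b c | a b c. distinct [a, b, c]}"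

text \<open>The leaves occurring in a triple set.\<close>

definition leaf_set :: "'a triple set \<Rightarrow> 'a set" where
  "leaf_set S = (\<Union>(p, c) \<in> S. insert c p)"

text \<open>
  Rooted trees with leaf set X.  Leaves are tagged by \<^const>\<open>Inl\<close>; the summand \<^typ>\<open>nat\<close>
  supplies inner vertices, so that every finite rooted tree with leaf set X occurs up to an
  isomorphism fixing the leaves, whatever the type of leaves.
\<close>

type_synonym 'a tree_graph = "('a + nat) pair_pre_digraph"

definition rooted_tree_on :: "'a set \<Rightarrow> 'a tree_graph \<Rightarrow> 'a + nat \<Rightarrow> bool" where
  "rooted_tree_on X T r \<longleftrightarrow> rooted_tree T r \<and> leaves T = Inl ` X"

definition displayed_triples :: "'a tree_graph \<Rightarrow> 'a + nat \<Rightarrow> 'a triple set" where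
  "displayed_triples T r = {triple a b c | a b c. displays T r (Inl a) (Inl b) (Inl c)}"

definition consistent :: "'a triple set \<Rightarrow> bool" where
  "consistent S \<longleftrightarrow> (\<exists>X T r. rooted_tree_on X T r \<and> S \<subseteq> displayed_triples T r)"

definition cl :: "'a triple set \<Rightarrow> 'a triple set" where
  "cl S = \<Inter> {displayed_triples T r | T r.
                rooted_tree_on (leaf_set S) T r \<and> S \<subseteq> displayed_triples T r}"

definition ahograph :: "'a triple set \<Rightarrow> 'a set \<Rightarrow> 'a pair_pre_digraph" where
  "ahograph S L = \<lparr> pverts = L,
     parcs = {(x, y). x \<in> L \<and> y \<in> L \<and> x \<noteq> y \<and> (\<exists>z \<in> L. triple x y z \<in> S)} \<rparr>"

text \<open>
  Connected components as vertex sets: the Ahograph is symmetric, so its strong components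
  are the connected components of the undirected graph.
\<close>

definition ahograph_components :: "'a triple set \<Rightarrow> 'a set \<Rightarrow> 'a set set" where
  "ahograph_components S L = pre_digraph.sccs_verts (with_proj (ahograph S L))"

text \<open>
  The set of unordered pairs written with a fraktur L for a triple r and a triple set S.
\<close>

definition component_pairs :: "'a triple \<Rightarrow> 'a triple set \<Rightarrow> 'a set set set" where
  "component_pairs r S = {{A, B} | A B. A \<subseteq> leaf_set S \<and> B \<subseteq> leaf_set S \<and> A \<noteq> B \<and>
     ahograph_components S (A \<union> B) = {A, B} \<and> fst r \<subseteq> A \<and> snd r \<in> B}"

text \<open>Starred versions: the unique pair of maximal total size, for a triple and for a set of triples.\<close>

definition max_pair :: "'a triple \<Rightarrow> 'a triple set \<Rightarrow> 'a set set" where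
  "max_pair r S = (THE P. is_arg_max (\<lambda>Q. card (\<Union>Q)) (\<lambda>Q. Q \<in> component_pairs r S) P)"

definition max_pairs :: "'a triple set \<Rightarrow> 'a triple set \<Rightarrow> 'a set set set" where
  "max_pairs S' S = {max_pair r S | r. r \<in> S'}"

end

theory Submission
  imports Defs
begin

text \<open>
  For consistent \<open>R\<close> every Ahograph on at least two leaves is disconnected.  Hence two pairs
  \<open>{A, B}\<close>, \<open>{A', B'}\<close> with \<open>A\<close> meeting \<open>A'\<close> and \<open>B\<close> meeting \<open>B'\<close> have a common upper bound
  \<open>{A \<union> A', B \<union> B'}\<close>, which makes maximal pairs unique.  Every triple \<open>ab|c\<close> in the closure of \<open>R'\<close> has
  some pair, since otherwise \<open>R'\<close> would stay consistent after adding \<open>ac|b\<close> or \<open>bc|a\<close>, and a tree for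
  the larger set would not display \<open>ab|c\<close>.  Replacing each edge of \<open>R\<close> by such a pair for \<open>R'\<close> shows
  that every pair for \<open>R\<close> lies below a pair for \<open>R'\<close>, while pairs for \<open>R'\<close> are pairs for \<open>R\<close>;
  so the maximal pairs agree.  Finally, the maximal pair of any triple of \<open>R\<close> is also the maximal
  pair of a triple of \<open>R'\<close> that has its two close leaves in one part and the third in the other.
\<close>

section \<open>Separable Ahographs and pairs of components\<close>

text \<open>\<open>rtrancl_on\<close> confines both ends to \<open>L\<close>, so this is an
  equivalence relation on exactly \<open>L\<close>; its classes are the components of the
  Ahograph.\<close>

definition linked :: "'a triple set \<Rightarrow> 'a set \<Rightarrow> 'a \<Rightarrow> 'a \<Rightarrow> bool" where
  "linked S L x y \<longleftrightarrow> (x, y) \<in> rtrancl_on L (parcs (ahograph S L))"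

lemma linked_refl: "x \<in> L \<Longrightarrow> linked S L x x"
  by (simp add: linked_def)

lemma linked_sym: "linked S L x y \<Longrightarrow> linked S L y x"
  unfolding linked_def
  by (rule symD[OF rtrancl_on_sym]) (auto simp: sym_def ahograph_def insert_commute)

lemma linked_trans: "linked S L x y \<Longrightarrow> linked S L y z \<Longrightarrow> linked S L x z"
  unfolding linked_def by (rule rtrancl_on_trans)

lemma linked_mono: "linked S L x y \<Longrightarrow> S \<subseteq> S' \<Longrightarrow> L \<subseteq> L' \<Longrightarrow> linked S' L' x y"
  unfolding linked_def by (erule rtrancl_on_mono[rotated 2]) (auto simp: ahograph_def)

lemma linked_in: "linked S L x y \<Longrightarrow> x \<in> L \<and> y \<in> L"
  unfolding linked_def by (auto dest: in_rtrancl_on_in_F)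

lemma linked_triple: "\<lbrakk>triple x y z \<in> S; x \<in> L; y \<in> L; z \<in> L\<rbrakk> \<Longrightarrow> linked S L x y"
  unfolding linked_def
  by (cases "x = y") (auto simp: ahograph_def intro: rtrancl_on_into_rtrancl_on)

text \<open>Induction along a walk. Most often \<open>P\<close> collects the points already known to
  be reached in another graph, so that edges can be replaced or discarded one at a time.\<close>

lemma linked_invariant:
  assumes "linked S L x y" "x \<in> P"
    "\<And>u v z. \<lbrakk>u \<in> P; u \<in> L; v \<in> L; z \<in> L; triple u v z \<in> S\<rbrakk> \<Longrightarrow> v \<in> P"
  shows "y \<in> P"
  using assms(1)[unfolded linked_def]
  by (induct rule: rtrancl_on_induct) (use assms(2,3) in \<open>auto simp: ahograph_def\<close>)

text \<open>Links are symmetric, so maximality of a strong component only has to be tested in one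
  direction.\<close>

lemma ahograph_components_eq:
  "ahograph_components S L = {C. C \<noteq> {} \<and> (\<forall>u\<in>C. \<forall>v\<in>C. linked S L u v) \<and>
     (\<forall>u\<in>C. \<forall>v. linked S L u v \<longrightarrow> v \<in> C)}"
proof -
  have r: "reachable (with_proj (ahograph S L)) u v \<longleftrightarrow> linked S L u v" for u v
    by (simp add: reachable_def linked_def) (simp add: ahograph_def)
  show ?thesis
    unfolding ahograph_components_def pre_digraph.sccs_verts_def r
    by (auto dest: linked_sym)
qed

text \<open>Disconnectedness of the Ahograph, put as a cut instead of a missing walk
  (\<open>separable_iff\<close>). A cut can be read off a tree and drives the recursion in
  \<open>hierarchy_exists\<close>.\<close>

definition separable :: "'a triple set \<Rightarrow> 'a set \<Rightarrow> bool" where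
  "separable S L \<longleftrightarrow> (\<exists>P. P \<noteq> {} \<and> P \<subset> L \<and>
     (\<forall>x\<in>P. \<forall>y\<in>L - P. \<forall>z\<in>L. triple x y z \<notin> S))"

lemma separableI:
  assumes "x \<in> L" "y \<in> L" "\<not> linked S L x y"
  shows "separable S L"
  unfolding separable_def
proof (intro exI[of _ "{v. linked S L x v}"] conjI ballI)
  fix u v z assume *: "u \<in> {v. linked S L x v}" "v \<in> L - {v. linked S L x v}" "z \<in> L"
  show "triple u v z \<notin> S"
  proof
    assume "triple u v z \<in> S"
    then have "linked S L u v" using * by (auto intro: linked_triple dest: linked_in)
    then show False using * by (auto dest: linked_trans)
  qed
next
  show "{v. linked S L x v} \<noteq> {}" using linked_refl[OF assms(1)] by auto
  show "{v. linked S L x v} \<subset> L" using assms by (auto dest: linked_in)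
qed

lemma separable_not_linked:
  assumes "separable S L" obtains x y where "x \<in> L" "y \<in> L" "\<not> linked S L x y"
proof -
  obtain P where P: "P \<noteq> {}" "P \<subset> L"
    "\<And>x y z. \<lbrakk>x \<in> P; y \<in> L - P; z \<in> L\<rbrakk> \<Longrightarrow> triple x y z \<notin> S"
    using assms unfolding separable_def by metis
  then obtain x y where xy: "x \<in> P" "y \<in> L" "y \<notin> P" by blast
  have "\<not> linked S L x y"
  proof
    assume "linked S L x y"
    from linked_invariant[OF this xy(1)] P(3) xy(3) show False by blast
  qed
  with that xy P(2) show thesis by blast
qed

lemma separable_iff: "separable S L \<longleftrightarrow> (\<exists>x\<in>L. \<exists>y\<in>L. \<not> linked S L x y)"
proof
  assume "separable S L"
  then show "\<exists>x\<in>L. \<exists>y\<in>L. \<not> linked S L x y" by (rule separable_not_linked) auto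
qed (auto intro: separableI)

lemma separable_antimono: "separable S' L \<Longrightarrow> S \<subseteq> S' \<Longrightarrow> separable S L"
  unfolding separable_iff by (auto dest: linked_mono[OF _ _ order_refl])

text \<open>A single link between the two connected parts would connect all of \<open>L\<close>,
  contrary to separability. Disjointness therefore comes out as a conclusion.\<close>

lemma two_components:
  assumes "separable S L" "L = A \<union> B" "A \<noteq> {}" "B \<noteq> {}"
    and A: "\<And>u v. \<lbrakk>u \<in> A; v \<in> A\<rbrakk> \<Longrightarrow> linked S L u v"
    and B: "\<And>u v. \<lbrakk>u \<in> B; v \<in> B\<rbrakk> \<Longrightarrow> linked S L u v"
  shows "ahograph_components S L = {A, B}" "A \<inter> B = {}"
proof -
  have n: "\<not> linked S L u v" if "u \<in> A" "v \<in> B" for u v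
  proof
    assume uv: "linked S L u v"
    have "linked S L w u" if "w \<in> L" for w
    proof (cases "w \<in> A")
      case True
      then show ?thesis using A \<open>u \<in> A\<close> by blast
    next
      case False
      then have "linked S L w v" using B \<open>v \<in> B\<close> that \<open>L = A \<union> B\<close> by blast
      then show ?thesis using linked_sym[OF uv] by (rule linked_trans)
    qed
    then have "linked S L x y" if "x \<in> L" "y \<in> L" for x y
      using that by (meson linked_trans linked_sym)
    then show False using \<open>separable S L\<close> unfolding separable_iff by blast
  qed
  have n': "\<not> linked S L v u" if "u \<in> A" "v \<in> B" for u v
    using n[OF that] linked_sym by metis
  show disj: "A \<inter> B = {}" using n A by blast
  show "ahograph_components S L = {A, B}"
  proof (intro equalityI subsetI)
    fix C assume "C \<in> ahograph_components S L"
    then have C: "C \<noteq> {}" "\<forall>u\<in>C. \<forall>v\<in>C. linked S L u v"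
      "\<forall>u\<in>C. \<forall>v. linked S L u v \<longrightarrow> v \<in> C"
      unfolding ahograph_components_eq mem_Collect_eq by blast+
    then obtain u where u: "u \<in> C" by blast
    have CL: "C \<subseteq> A \<union> B" using C(2) linked_in[of S L] assms(2) by blast
    with u consider "u \<in> A" | "u \<in> B" by blast
    then show "C \<in> {A, B}"
    proof cases
      case 1
      have "A \<subseteq> C" using A[OF 1] C(3) u by blast
      moreover have "C \<inter> B = {}" using n[OF 1] C(2) u by blast
      ultimately show ?thesis using CL by blast
    next
      case 2
      have "B \<subseteq> C" using B[OF 2] C(3) u by blast
      moreover have "C \<inter> A = {}" using n'[OF _ 2] C(2) u by blast
      ultimately show ?thesis using CL by blast
    qed
  next
    have in_AB: "v \<in> A \<union> B" if "linked S L u v" for u v using linked_in[OF that] assms(2) by simp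
    have "A \<in> ahograph_components S L"
      unfolding ahograph_components_eq using assms(3) A n in_AB by simp blast
    moreover have "B \<in> ahograph_components S L"
      unfolding ahograph_components_eq using assms(4) B n' in_AB by simp blast
    ultimately show "C \<in> ahograph_components S L" if "C \<in> {A, B}" for C using that by auto
  qed
qed

lemma componentsD:
  assumes "ahograph_components S L = {A, B}"
  shows "A \<noteq> {}" "B \<noteq> {}"
    "\<And>u v. \<lbrakk>u \<in> A; v \<in> A\<rbrakk> \<Longrightarrow> linked S L u v" "\<And>u v. \<lbrakk>u \<in> B; v \<in> B\<rbrakk> \<Longrightarrow> linked S L u v"
proof -
  have "A \<in> ahograph_components S L" "B \<in> ahograph_components S L" using assms by auto
  then have *: "A \<noteq> {}" "\<forall>u\<in>A. \<forall>v\<in>A. linked S L u v" "B \<noteq> {}" "\<forall>u\<in>B. \<forall>v\<in>B. linked S L u v"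
    unfolding ahograph_components_eq by blast+
  show "A \<noteq> {}" "B \<noteq> {}"
    "\<And>u v. \<lbrakk>u \<in> A; v \<in> A\<rbrakk> \<Longrightarrow> linked S L u v" "\<And>u v. \<lbrakk>u \<in> B; v \<in> B\<rbrakk> \<Longrightarrow> linked S L u v"
    using * by blast+
qed

section \<open>Aho's criterion and the calculus of pairs of components\<close>

text \<open>For triple sets with finite leaf set this characterises consistency:
  \<open>consistentD\<close> gives one direction, \<open>aho_separable_tree\<close> the
  other.\<close>

definition aho_separable :: "'a triple set \<Rightarrow> bool" where
  "aho_separable S \<longleftrightarrow> (\<forall>L. (\<exists>x\<in>L. \<exists>y\<in>L. x \<noteq> y) \<longrightarrow> separable S L)"

lemma aho_separableD: "aho_separable S \<Longrightarrow> x \<in> L \<Longrightarrow> y \<in> L \<Longrightarrow> x \<noteq> y \<Longrightarrow> separable S L"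
  unfolding aho_separable_def by blast

lemma aho_separable_antimono: "aho_separable S' \<Longrightarrow> S \<subseteq> S' \<Longrightarrow> aho_separable S"
  unfolding aho_separable_def by (blast intro: separable_antimono)

text \<open>The oriented form of a member of \<open>component_pairs\<close>: it records which part
  holds \<open>a\<close> and \<open>b\<close>. Repeated leaves such as \<open>a\<close>,
  \<open>a\<close>, \<open>c\<close> are allowed.\<close>

definition component_split :: "'a triple set \<Rightarrow> 'a \<Rightarrow> 'a \<Rightarrow> 'a \<Rightarrow> 'a set \<Rightarrow> 'a set \<Rightarrow> bool" where
  "component_split S a b c A B \<longleftrightarrow> A \<subseteq> leaf_set S \<and> B \<subseteq> leaf_set S \<and> A \<noteq> B \<and>
     ahograph_components S (A \<union> B) = {A, B} \<and> a \<in> A \<and> b \<in> A \<and> c \<in> B"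

lemma component_pairs_eq:
  "component_pairs (triple a b c) S = {{A, B} | A B. component_split S a b c A B}"
  unfolding component_pairs_def component_split_def by auto

lemma splitI:
  assumes "A \<union> B \<subseteq> leaf_set S" "a \<in> A" "b \<in> A" "c \<in> B" "L = A \<union> B" "separable S L"
    and "\<And>u v. \<lbrakk>u \<in> A; v \<in> A\<rbrakk> \<Longrightarrow> linked S L u v" "\<And>u v. \<lbrakk>u \<in> B; v \<in> B\<rbrakk> \<Longrightarrow> linked S L u v"
  shows "component_split S a b c A B"
proof -
  have "A \<noteq> {}" "B \<noteq> {}" using assms by auto
  then have "ahograph_components S L = {A, B}" "A \<inter> B = {}"
    using two_components[OF \<open>separable S L\<close> \<open>L = A \<union> B\<close>] assms(7,8) by simp_all
  then show ?thesis using assms(1-5) unfolding component_split_def by auto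
qed

lemma splitD:
  assumes "component_split S a b c A B"
  shows "A \<subseteq> leaf_set S" "B \<subseteq> leaf_set S" "A \<noteq> B" "ahograph_components S (A \<union> B) = {A, B}"
    "a \<in> A" "b \<in> A" "c \<in> B"
    "\<And>u v. \<lbrakk>u \<in> A; v \<in> A\<rbrakk> \<Longrightarrow> linked S (A \<union> B) u v" "\<And>u v. \<lbrakk>u \<in> B; v \<in> B\<rbrakk> \<Longrightarrow> linked S (A \<union> B) u v"
proof -
  show *: "A \<subseteq> leaf_set S" "B \<subseteq> leaf_set S" "A \<noteq> B" "ahograph_components S (A \<union> B) = {A, B}"
    "a \<in> A" "b \<in> A" "c \<in> B"
    using assms unfolding component_split_def by simp_all
  show "\<And>u v. \<lbrakk>u \<in> A; v \<in> A\<rbrakk> \<Longrightarrow> linked S (A \<union> B) u v"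
    "\<And>u v. \<lbrakk>u \<in> B; v \<in> B\<rbrakk> \<Longrightarrow> linked S (A \<union> B) u v"
    using componentsD(3,4)[OF *(4)] by blast+
qed

lemma split_distinct_points:
  assumes "component_split S a b c A B" shows "\<exists>x\<in>A \<union> B. \<exists>y\<in>A \<union> B. x \<noteq> y"
proof -
  have ne: "A \<noteq> {}" "B \<noteq> {}" using splitD(5,7)[OF assms] by blast+
  consider x where "x \<in> A" "x \<notin> B" | x where "x \<in> B" "x \<notin> A" using splitD(3)[OF assms] by blast
  then show ?thesis
  proof cases
    case 1
    then have "\<exists>y\<in>B. x \<noteq> y" using ne(2) by auto
    then show ?thesis using 1 by blast
  next
    case 2
    then have "\<exists>y\<in>A. x \<noteq> y" using ne(1) by auto
    then show ?thesis using 2 by blast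
  qed
qed

lemma split_separable:
  assumes "aho_separable S'" "component_split S a b c A B" "A \<union> B \<subseteq> L"
  shows "separable S' L"
  using split_distinct_points[OF assms(2)] assms(1,3) unfolding aho_separable_def by blast

text \<open>More triples keep \<open>A\<close> and \<open>B\<close> connected, and separability of
  \<open>S'\<close> prevents the two from merging.\<close>

lemma split_mono:
  assumes "aho_separable S'" "S \<subseteq> S'" "leaf_set S \<subseteq> leaf_set S'" "component_split S a b c A B"
  shows "component_split S' a b c A B"
proof (rule splitI[OF _ _ _ _ refl])
  note s = splitD[OF assms(4)]
  show "separable S' (A \<union> B)" by (rule split_separable[OF assms(1,4)]) blast
  show "A \<union> B \<subseteq> leaf_set S'" using s(1,2) assms(3) by blast
  show "linked S' (A \<union> B) u v" if "u \<in> A" "v \<in> A" for u v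
    using linked_mono[OF s(8)[OF that] assms(2) order_refl] .
  show "linked S' (A \<union> B) u v" if "u \<in> B" "v \<in> B" for u v
    using linked_mono[OF s(9)[OF that] assms(2) order_refl] .
qed (use splitD[OF assms(4)] in simp_all)

text \<open>Common points make \<open>A \<union> A'\<close> and \<open>B \<union> B'\<close>
  connected, and separability of the whole keeps them apart. This makes the pairs for a triple
  upward directed.\<close>

lemma split_union:
  assumes "aho_separable S" "component_split S a b c A B" "component_split S a' b' c' A' B'"
    "A \<inter> A' \<noteq> {}" "B \<inter> B' \<noteq> {}"
  shows "component_split S a b c (A \<union> A') (B \<union> B')"
proof (rule splitI[OF _ _ _ _ refl])
  note 1 = splitD[OF assms(2)] and 2 = splitD[OF assms(3)]
  let ?L = "(A \<union> A') \<union> (B \<union> B')"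
  have l: "linked S ?L u v" if "linked S (A \<union> B) u v \<or> linked S (A' \<union> B') u v" for u v
    using that linked_mono[of S _ u v S ?L] by blast
  obtain p q where pq: "p \<in> A" "p \<in> A'" "q \<in> B" "q \<in> B'" using assms(4,5) by blast
  have A: "linked S ?L u p" if "u \<in> A \<union> A'" for u using that l 1(8)[OF _ pq(1)] 2(8)[OF _ pq(2)] by blast
  have B: "linked S ?L u q" if "u \<in> B \<union> B'" for u using that l 1(9)[OF _ pq(3)] 2(9)[OF _ pq(4)] by blast
  show "linked S ?L u v" if "u \<in> A \<union> A'" "v \<in> A \<union> A'" for u v
    using linked_trans[OF A[OF that(1)] linked_sym[OF A[OF that(2)]]] .
  show "linked S ?L u v" if "u \<in> B \<union> B'" "v \<in> B \<union> B'" for u v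
    using linked_trans[OF B[OF that(1)] linked_sym[OF B[OF that(2)]]] .
  show "separable S ?L" by (rule split_separable[OF assms(1,2)]) blast
  show "A \<union> A' \<union> (B \<union> B') \<subseteq> leaf_set S" using 1(1,2) 2(1,2) by blast
qed (use splitD(5-7)[OF assms(2)] in simp_all)

section \<open>Maximal pairs: uniqueness and transfer between nested triple sets\<close>

text \<open>There are finitely many pairs, so a maximum exists. Two maximal pairs have a common
  upper bound by \<open>split_union\<close>, hence cover the same points, and a pair is determined
  by the set that it covers.\<close>

lemma max_pair_unique:
  assumes aho: "aho_separable S" and fin: "finite (leaf_set S)"
    and ne: "component_pairs (triple a b c) S \<noteq> {}"
  shows "\<exists>!P. is_arg_max (\<lambda>Q. card (\<Union>Q)) (\<lambda>Q. Q \<in> component_pairs (triple a b c) S) P"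
proof (rule ex_ex1I)
  have "component_pairs (triple a b c) S \<subseteq> Pow (Pow (leaf_set S))"
    unfolding component_pairs_def by auto
  then have f: "finite (component_pairs (triple a b c) S)"
    using fin finite_subset by blast
  then obtain P where P: "P \<in> component_pairs (triple a b c) S"
    "Max ((\<lambda>Q. card (\<Union>Q)) ` component_pairs (triple a b c) S) = card (\<Union>P)"
    using ne by (auto dest: Max_in[OF finite_imageI, of _ "\<lambda>Q. card (\<Union>Q)"])
  have "card (\<Union>Q) \<le> card (\<Union>P)" if "Q \<in> component_pairs (triple a b c) S" for Q
    unfolding P(2)[symmetric] by (rule Max_ge) (use that f in auto)
  then show "\<exists>P. is_arg_max (\<lambda>Q. card (\<Union>Q)) (\<lambda>Q. Q \<in> component_pairs (triple a b c) S) P"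
    using P(1) unfolding is_arg_max_linorder by blast
next
  fix P Q
  assume P: "is_arg_max (\<lambda>Q. card (\<Union>Q)) (\<lambda>Q. Q \<in> component_pairs (triple a b c) S) P"
    and Q: "is_arg_max (\<lambda>Q. card (\<Union>Q)) (\<lambda>Q. Q \<in> component_pairs (triple a b c) S) Q"
  obtain A B where AB: "component_split S a b c A B" "P = {A, B}"
    using P unfolding is_arg_max_def component_pairs_eq by auto
  obtain A' B' where AB': "component_split S a b c A' B'" "Q = {A', B'}"
    using Q unfolding is_arg_max_def component_pairs_eq by auto
  note s = AB(1) AB'(1) AB(2) AB'(2)
  let ?U = "{A \<union> A', B \<union> B'}"
  have "component_split S a b c (A \<union> A') (B \<union> B')"
    using split_union[OF aho s(1,2)] splitD(5,7)[OF s(1)] splitD(5,7)[OF s(2)] by blast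
  then have U: "?U \<in> component_pairs (triple a b c) S" unfolding component_pairs_eq by blast
  have fU: "finite (\<Union>?U)" using splitD(1,2)[OF s(1)] splitD(1,2)[OF s(2)] fin
    by (simp add: finite_subset)
  have "\<Union>P = \<Union>?U"
    by (rule card_seteq[OF fU]) (use P U s in \<open>auto simp: is_arg_max_linorder\<close>)
  moreover have "\<Union>Q = \<Union>?U"
    by (rule card_seteq[OF fU]) (use Q U s in \<open>auto simp: is_arg_max_linorder\<close>)
  ultimately have "A \<union> B = A' \<union> B'" using s(3,4) by simp
  \<comment> \<open>Both pairs are the set of components of the Ahograph on the same vertex
    set.\<close>
  then show "P = Q" using s(3,4) splitD(4)[OF s(1)] splitD(4)[OF s(2)] by simp
qed

lemma max_pair_is_arg_max:
  assumes "aho_separable S" "finite (leaf_set S)" "component_pairs (triple a b c) S \<noteq> {}"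
  shows "is_arg_max (\<lambda>Q. card (\<Union>Q)) (\<lambda>Q. Q \<in> component_pairs (triple a b c) S)
    (max_pair (triple a b c) S)"
  unfolding max_pair_def by (rule theI'[OF max_pair_unique[OF assms]])

lemma max_pair_eqI:
  assumes "aho_separable S" "finite (leaf_set S)"
    "is_arg_max (\<lambda>Q. card (\<Union>Q)) (\<lambda>Q. Q \<in> component_pairs (triple a b c) S) P"
  shows "max_pair (triple a b c) S = P"
  unfolding max_pair_def
  by (rule the1_equality[OF max_pair_unique[OF assms(1,2)] assms(3)])
    (use assms(3) in \<open>auto simp: is_arg_max_def\<close>)

text \<open>
  Enlarge \<open>A \<union> B\<close> by a pair \<open>X, Y\<close> for each triple of \<open>R\<close> that yields an edge on \<open>A \<union> B\<close>: \<open>X\<close> replaces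
  the edge by a path for \<open>R'\<close>, and both \<open>X\<close> and \<open>Y\<close> meet \<open>A \<union> B\<close>, so no further component arises.
\<close>

lemma split_dominated:
  assumes aho: "aho_separable R'"
    and cover: "\<And>x y z. triple x y z \<in> R \<Longrightarrow> \<exists>X Y. component_split R' x y z X Y"
    and leaf: "leaf_set R = leaf_set R'"
    and AB: "component_split R a b c A B"
  shows "\<exists>A' B'. component_split R' a b c A' B' \<and> A \<subseteq> A' \<and> B \<subseteq> B'"
proof -
  note AB' = splitD[OF AB]
  \<comment> \<open>Collecting all splits at three leaves of \<open>A \<union> B\<close> avoids
    choosing one for each triple of \<open>R\<close>.\<close>
  define W where "W = {(x, y, z, X, Y). x \<in> A \<union> B \<and> y \<in> A \<union> B \<and> z \<in> A \<union> B \<and>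
    component_split R' x y z X Y}"
  define L where "L = A \<union> B \<union> (\<Union>(x, y, z, X, Y) \<in> W. X \<union> Y)"
  have sub: "X \<union> Y \<subseteq> L" if "(x, y, z, X, Y) \<in> W" for x y z X Y
    using that unfolding L_def by force
  have ABL: "A \<union> B \<subseteq> L" unfolding L_def by blast
  have WL: "linked R' L u v" if w: "(x, y, z, X, Y) \<in> W" and uv: "u \<in> X \<and> v \<in> X \<or> u \<in> Y \<and> v \<in> Y"
    for u v x y z X Y
  proof -
    have "component_split R' x y z X Y" using w unfolding W_def by simp
    from splitD(8,9)[OF this] have "linked R' (X \<union> Y) u v" using uv by blast
    then show ?thesis using sub[OF w] by (rule linked_mono[OF _ order_refl])
  qed
  have step: "linked R' L u v" if "linked R (A \<union> B) u v" for u v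
  proof -
    have "u \<in> A \<union> B" using linked_in[OF that] by blast
    then have "v \<in> {v. linked R' L u v}"
    proof (intro linked_invariant[OF that], goal_cases)
      case 1 then show ?case using ABL by (auto intro: linked_refl)
    next
      case (2 p q z)
      \<comment> \<open>The edge from \<open>p\<close> to \<open>q\<close> stems from a triple of
        \<open>R\<close> with third leaf \<open>z\<close>; both ends lie in the part
        \<open>X\<close> of its split, which is connected in the graph of \<open>R'\<close>.\<close>
      then obtain X Y where XY: "component_split R' p q z X Y" using cover by blast
      then have "(p, q, z, X, Y) \<in> W" using 2 unfolding W_def by blast
      then have "linked R' L p q" using splitD(5,6)[OF XY] WL by simp
      moreover have "linked R' L u p" using 2 by simp
      ultimately show ?case using linked_trans[of R' L u p q] by simp
    qed
    then show ?thesis by blast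
  qed
  let ?A = "{u. linked R' L a u}" and ?B = "{u. linked R' L c u}"
  have A: "A \<subseteq> ?A" and B: "B \<subseteq> ?B" using AB'(5,7) step[OF AB'(8)] step[OF AB'(9)] by blast+
  have "L \<subseteq> ?A \<union> ?B"
  proof
    fix u assume "u \<in> L"
    then consider "u \<in> A \<union> B" | x y z X Y where "(x, y, z, X, Y) \<in> W" "u \<in> X \<or> u \<in> Y"
      unfolding L_def by fast
    then show "u \<in> ?A \<union> ?B"
    proof cases
      case 1 then show ?thesis using A B by blast
    next
      case 2
      then have xz: "x \<in> A \<union> B" "z \<in> A \<union> B" and "component_split R' x y z X Y"
        unfolding W_def by simp_all
      \<comment> \<open>\<open>x\<close> lies in \<open>X\<close> and \<open>z\<close> in
        \<open>Y\<close>, so each added part is tied to a point of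
        \<open>A \<union> B\<close>.\<close>
      then have "linked R' L x u \<or> linked R' L z u"
        using splitD(5,7) WL[OF 2(1)] 2(2) by metis
      moreover have "linked R' L a v \<or> linked R' L c v" if "v \<in> A \<union> B" for v using that A B by blast
      ultimately have "linked R' L a u \<or> linked R' L c u" using xz linked_trans by metis
      then show ?thesis by blast
    qed
  qed
  moreover have "?A \<union> ?B \<subseteq> L" by (auto dest: linked_in)
  ultimately have L: "L = ?A \<union> ?B" by blast
  have "X \<union> Y \<subseteq> leaf_set R'" if "(x, y, z, X, Y) \<in> W" for x y z X Y
  proof -
    have "component_split R' x y z X Y" using that unfolding W_def by simp
    from splitD(1,2)[OF this] show ?thesis by simp
  qed
  then have "(\<Union>(x, y, z, X, Y) \<in> W. X \<union> Y) \<subseteq> leaf_set R'" by (blast elim: case_prodE)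
  then have leafs: "L \<subseteq> leaf_set R'" using AB'(1,2) leaf unfolding L_def by simp
  have "component_split R' a b c ?A ?B"
  proof (rule splitI[OF _ _ _ _ L])
    show "separable R' L" by (rule split_separable[OF aho AB ABL])
    show "?A \<union> ?B \<subseteq> leaf_set R'" using L leafs by simp
    show "a \<in> ?A" "b \<in> ?A" "c \<in> ?B" using A B AB'(5-7) by auto
    show "linked R' L u v" if "u \<in> ?A" "v \<in> ?A" for u v
      using that linked_trans[OF linked_sym] by simp
    show "linked R' L u v" if "u \<in> ?B" "v \<in> ?B" for u v
      using that linked_trans[OF linked_sym] by simp
  qed
  then show ?thesis using A B by blast
qed

text \<open>The maximal pair for \<open>R'\<close> is a pair for \<open>R\<close> by
  \<open>split_mono\<close>, and no pair for \<open>R\<close> is larger, since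
  \<open>split_dominated\<close> places each one below a pair for \<open>R'\<close>.\<close>

lemma max_pair_transfer:
  assumes aho: "aho_separable R" and sub: "R' \<subseteq> R" and fin: "finite (leaf_set R)"
    and cover: "\<And>x y z. triple x y z \<in> R \<Longrightarrow> \<exists>X Y. component_split R' x y z X Y"
    and leaf: "leaf_set R = leaf_set R'"
    and ex: "component_pairs (triple a b c) R' \<noteq> {}"
  shows "max_pair (triple a b c) R' = max_pair (triple a b c) R"
proof (rule max_pair_eqI[OF aho fin, symmetric])
  have aho': "aho_separable R'" using aho sub by (rule aho_separable_antimono)
  let ?P = "max_pair (triple a b c) R'"
  have max: "?P \<in> component_pairs (triple a b c) R'"
    "\<And>Q. Q \<in> component_pairs (triple a b c) R' \<Longrightarrow> card (\<Union>Q) \<le> card (\<Union>?P)"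
    using max_pair_is_arg_max[OF aho' fin[unfolded leaf] ex]
    unfolding is_arg_max_linorder by simp_all
  obtain A B where "?P = {A, B}" and AB: "component_split R' a b c A B"
    using max(1) unfolding component_pairs_eq by blast
  moreover have "component_split R a b c A B"
    by (rule split_mono[OF aho sub _ AB]) (simp add: leaf)
  ultimately have "?P \<in> component_pairs (triple a b c) R"
    unfolding component_pairs_eq by blast
  moreover have "card (\<Union>Q) \<le> card (\<Union>?P)" if mem: "Q \<in> component_pairs (triple a b c) R" for Q
  proof -
    obtain A B where AB: "Q = {A, B}" "component_split R a b c A B"
      using mem unfolding component_pairs_eq by blast
    obtain A' B' where AB': "component_split R' a b c A' B'" "A \<subseteq> A'" "B \<subseteq> B'"
      using split_dominated[OF aho' cover leaf AB(2)] by blast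
    have "finite (A' \<union> B')" using splitD(1,2)[OF AB'(1)] fin leaf by (simp add: finite_subset)
    then have "card (\<Union>Q) \<le> card (\<Union>{A', B'})" using AB AB' by (auto intro!: card_mono)
    also have "\<dots> \<le> card (\<Union>?P)"
      using AB'(1) by (intro max(2)) (auto simp: component_pairs_eq)
    finally show ?thesis .
  qed
  ultimately show "is_arg_max (\<lambda>Q. card (\<Union>Q)) (\<lambda>Q. Q \<in> component_pairs (triple a b c) R) ?P"
    unfolding is_arg_max_linorder by blast
qed

text \<open>
  Otherwise every edge within \<open>A\<close> would come from a triple with all leaves in \<open>A\<close>, so that the
  Ahograph on \<open>A\<close> alone would be connected.
\<close>

lemma split_crossing_triple:
  assumes aho: "aho_separable S" and AB: "component_split S a b c A B" and "a \<noteq> b"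
  shows "\<exists>x y z. triple x y z \<in> S \<and> x \<in> A \<and> y \<in> A \<and> z \<in> B"
proof (rule ccontr)
  assume no: "\<nexists>x y z. triple x y z \<in> S \<and> x \<in> A \<and> y \<in> A \<and> z \<in> B"
  note AB' = splitD[OF AB]
  have comp: "v \<in> A" if "u \<in> A" "linked S (A \<union> B) u v" for u v
  proof -
    have "A \<in> ahograph_components S (A \<union> B)" using AB'(4) by simp
    then show ?thesis using that unfolding ahograph_components_eq by blast
  qed
  have "linked S A u v" if "u \<in> A" "v \<in> A" for u v
  proof -
    have "v \<in> {v. linked S A u v}"
    proof (rule linked_invariant[OF AB'(8)[OF that]])
      fix p q z assume *: "p \<in> {v. linked S A u v}" "q \<in> A \<union> B" "z \<in> A \<union> B" "triple p q z \<in> S"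
      then have p: "p \<in> A" by (auto dest: linked_in)
      have "linked S (A \<union> B) p q" using * p by (auto intro: linked_triple)
      then have q: "q \<in> A" by (rule comp[OF p])
      then have "z \<in> A" using no p * by blast
      then have "linked S A p q" using p q * by (auto intro: linked_triple)
      then show "q \<in> {v. linked S A u v}" using * by (auto intro: linked_trans)
    qed (use that linked_refl in auto)
    then show ?thesis by blast
  qed
  moreover have "separable S A" using aho_separableD[OF aho AB'(5,6) \<open>a \<noteq> b\<close>] .
  ultimately show False unfolding separable_iff by blast
qed

text \<open>A triple of \<open>S\<close> crossing the maximal pair in the right way has that pair
  among its own. A larger pair for it would unite with the first one to a larger pair for
  \<open>ab|c\<close>.\<close>

lemma max_pair_crossing:
  assumes aho: "aho_separable S" and fin: "finite (leaf_set S)" and "a \<noteq> b"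
    and ex: "component_pairs (triple a b c) S \<noteq> {}"
  shows "\<exists>x y z. triple x y z \<in> S \<and> max_pair (triple x y z) S = max_pair (triple a b c) S"
proof -
  let ?P = "max_pair (triple a b c) S"
  have max: "?P \<in> component_pairs (triple a b c) S"
    "\<And>Q. Q \<in> component_pairs (triple a b c) S \<Longrightarrow> card (\<Union>Q) \<le> card (\<Union>?P)"
    using max_pair_is_arg_max[OF aho fin ex] unfolding is_arg_max_linorder by simp_all
  obtain A B where P: "?P = {A, B}" and AB: "component_split S a b c A B"
    using max(1) unfolding component_pairs_eq by blast
  obtain x y z where xyz: "triple x y z \<in> S" "x \<in> A" "y \<in> A" "z \<in> B"
    using split_crossing_triple[OF aho AB \<open>a \<noteq> b\<close>] by blast
  have AB2: "component_split S x y z A B" using AB xyz unfolding component_split_def by simp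
  have "card (\<Union>Q) \<le> card (\<Union>?P)" if mem: "Q \<in> component_pairs (triple x y z) S" for Q
  proof -
    obtain A' B' where Q: "Q = {A', B'}" and Q': "component_split S x y z A' B'"
      using mem unfolding component_pairs_eq by blast
    have "component_split S a b c (A \<union> A') (B \<union> B')"
      using split_union[OF aho AB Q'] xyz(2,4) splitD(5,7)[OF Q'] by blast
    then have "{A \<union> A', B \<union> B'} \<in> component_pairs (triple a b c) S"
      unfolding component_pairs_eq by blast
    then have "card (\<Union>{A \<union> A', B \<union> B'}) \<le> card (\<Union>?P)" by (rule max(2))
    moreover have "finite (\<Union>{A \<union> A', B \<union> B'})"
      using splitD(1,2)[OF AB] splitD(1,2)[OF Q'] fin by (simp add: finite_subset)
    then have "card (\<Union>Q) \<le> card (\<Union>{A \<union> A', B \<union> B'})"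
      by (rule card_mono) (auto simp: Q)
    ultimately show ?thesis by linarith
  qed
  moreover have "?P \<in> component_pairs (triple x y z) S" unfolding P component_pairs_eq using AB2 by blast
  ultimately have "max_pair (triple x y z) S = ?P"
    by (intro max_pair_eqI[OF aho fin]) (simp add: is_arg_max_linorder)
  then show ?thesis using xyz(1) by blast
qed

section \<open>Triples displayed by a tree\<close>

text \<open>Otherwise the walk shortens to a path from \<open>u\<close> to \<open>u'\<close>
  avoiding \<open>v\<close>, which the two arcs at \<open>v\<close> close to a cycle.\<close>

lemma tree_unique_exit:
  assumes T: "undirected_tree T" and arcs: "(v, u) \<in> parcs T" "(v, u') \<in> parcs T"
    and p: "pre_digraph.awalk (with_proj T) u p u'" "v \<notin> set (pawalk_verts u p)"
  shows "u = u'"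
proof (rule ccontr)
  assume "u \<noteq> u'"
  interpret pair_graph T using T unfolding undirected_tree_def by blast
  define q where "q = awalk_to_apath p"
  have q: "apath u q u'" unfolding q_def by (rule apath_awalk_to_apath[OF p(1)])
  have aw: "awalk u q u'" using q by (simp add: apath_def)
  have q_sub: "set (pawalk_verts u q) \<subseteq> set (pawalk_verts u p)"
    using awalk_to_apath_subset[OF p(1)] set_awalk_verts[OF aw] set_awalk_verts[OF p(1)]
    unfolding q_def by auto
  have "q \<noteq> []" using q \<open>u \<noteq> u'\<close> by (auto simp: apath_Nil_iff)
  let ?c = "(v, u) # q @ [(u', v)]"
  have arc: "(u', v) \<in> parcs T" using arcs(2) by (rule arcs_symmetric)
  have "awalk v ?c v"
    using aw arcs(1) arc in_arcsD1[OF arcs(1)] by (simp add: awalk_simps)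
  moreover have "pawalk_verts u (q @ [(u', v)]) = pawalk_verts u q @ [v]"
    using aw by (simp add: awalk_verts_append awalk_appendI awalk_simps arc in_arcsD1[OF arcs(1)])
  then have "distinct (tl (pawalk_verts v ?c))"
    using q q_sub p(2) by (auto simp: apath_def)
  ultimately have "cycle ?c" unfolding cycle_def by auto
  \<comment> \<open>The path \<open>q\<close> has an arc because its ends differ; this rules out the
    harmless walk back and forth along one edge.\<close>
  moreover have "3 \<le> length ?c" using \<open>q \<noteq> []\<close> by (cases q) auto
  ultimately show False using T unfolding undirected_tree_def by blast
qed

lemma tree_apath_exists:
  assumes T: "undirected_tree T" and "u \<in> pverts T" "v \<in> pverts T"
  shows "\<exists>p. pre_digraph.apath (with_proj T) u p v"
proof -
  interpret pair_graph T using T unfolding undirected_tree_def by blast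
  have "strongly_connected (with_proj T)"
    using T sym_arcs symmetric_connected_imp_strongly_connected unfolding undirected_tree_def by blast
  then show ?thesis using assms(2,3) reachable_apath by (auto elim: strongly_connectedE)
qed

text \<open>Supplies the neighbour \<open>u\<close> of \<open>v\<close> on the side of
  \<open>z\<close>, together with the part of the path before \<open>v\<close>.\<close>

lemma apath_predecessor:
  assumes T: "undirected_tree T" and p: "pre_digraph.apath (with_proj T) z p r"
    and v: "v \<in> set (pawalk_verts z p)" "v \<noteq> z"
  shows "\<exists>q u vs. pre_digraph.awalk (with_proj T) z q u \<and> (u, v) \<in> parcs T \<and>
    pawalk_verts z p = pawalk_verts z q @ v # vs"
proof -
  interpret pair_graph T using T unfolding undirected_tree_def by blast
  have aw: "awalk z p r" using p by (simp add: apath_def)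
  then have "pcas z p r" by (simp add: awalk_def)
  obtain xs vs where W: "pawalk_verts z p = xs @ v # vs" using v(1) by (meson split_list)
  obtain p1 p2 where p12: "pcas z p1 v" "p = p1 @ p2" "pawalk_verts z p1 = xs @ [v]"
    using awalk_decomp_verts[OF \<open>pcas z p r\<close> W] by metis
  have aw1: "awalk z p1 v" using aw p12(1,2) by (auto simp: awalk_def)
  then have "p1 \<noteq> []" using v(2) by (auto simp: awalk_Nil_iff)
  then obtain q u w where q: "p1 = q @ [(u, w)]" by (cases p1 rule: rev_cases) auto
  have "awalk z q u" "w = v" "(u, v) \<in> parcs T"
    using aw1 unfolding q by (auto simp: awalk_simps)
  moreover have "xs = pawalk_verts z q"
    using p12(3) awalk_verts_append[of z q "[(u, w)]" v] aw1 unfolding q by simp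
  ultimately show ?thesis using W by blast
qed

text \<open>
  Let \<open>v\<close> be the last common vertex of the paths from the root to the elements of \<open>X\<close>.
  A displayed triple \<open>xy|z\<close> within \<open>X\<close> has \<open>x\<close> and \<open>y\<close> in a single component of the tree minus \<open>v\<close>;
  if that component contained all of \<open>X\<close>, then the neighbour of \<open>v\<close> in it
  would be a later common vertex.
\<close>

lemma displays_separable:
  assumes rt: "rooted_tree T r" and X: "x1 \<in> X" "x2 \<in> X" "x1 \<noteq> x2"
  shows "\<exists>P. P \<noteq> {} \<and> P \<subset> X \<and> (\<forall>x\<in>P. \<forall>y\<in>X - P. \<forall>z\<in>X. \<not> displays T r x y z)"
proof (rule ccontr)
  assume neg: "\<not> ?thesis"
  have T: "undirected_tree T" and r: "r \<in> pverts T"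
    using rt unfolding rooted_tree_def inner_vertices_def by auto
  interpret pair_graph T using T unfolding undirected_tree_def by blast
  \<comment> \<open>The negated claim: every cut of \<open>X\<close> is crossed by a displayed
    triple.\<close>
  have cross: "\<exists>x\<in>P. \<exists>y\<in>X - P. \<exists>z\<in>X. displays T r x y z" if "P \<noteq> {}" "P \<subset> X" for P
  proof (rule ccontr)
    assume "\<not> (\<exists>x\<in>P. \<exists>y\<in>X - P. \<exists>z\<in>X. displays T r x y z)"
    then have "\<forall>x\<in>P. \<forall>y\<in>X - P. \<forall>z\<in>X. \<not> displays T r x y z" by simp
    with that have "P \<noteq> {} \<and> P \<subset> X \<and> (\<forall>x\<in>P. \<forall>y\<in>X - P. \<forall>z\<in>X. \<not> displays T r x y z)"
      by simp
    with neg show False by (elim notE) (rule exI)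
  qed
  have single: "\<exists>y\<in>X. \<exists>z\<in>X. displays T r x y z" if "x \<in> X" for x
  proof -
    have "{x} \<subset> X" using that X by auto
    from cross[OF _ this] show ?thesis by auto
  qed
  have verts: "x \<in> pverts T" if "x \<in> X" for x
    using single[OF that] unfolding displays_def leaves_def by auto
  have disj: "set (pawalk_verts x p) \<inter> set (pawalk_verts z q) = {}"
    if "displays T r x y z" "apath x p y" "apath z q r" for x y z p q
    using that unfolding displays_def awalk_verts_with_proj_eq by blast
  have end_in: "b \<in> set (pawalk_verts a p)" if "awalk a p b" for a p b
  proof -
    have "last (pawalk_verts a p) = b" "pawalk_verts a p \<noteq> []" using that by auto
    then show ?thesis using last_in_set by metis
  qed
  have "\<forall>z\<in>X. \<exists>q. apath z q r" using tree_apath_exists[OF T verts r] by blast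
  then obtain q where q: "\<And>z. z \<in> X \<Longrightarrow> apath z (q z) r" by metis
  define W where "W z = pawalk_verts z (q z)" for z
  have "r \<in> set (W z)" if "z \<in> X" for z
    using q[OF that] end_in unfolding W_def apath_def by simp
  then have "\<exists>v\<in>set (W x1). \<forall>z\<in>X. v \<in> set (W z)" using X(1) by blast
  \<comment> \<open>The paths \<open>W z\<close> run towards the root, so the first common vertex on
    \<open>W x1\<close> is the last one seen from the root.\<close>
  then obtain ys v vs where split: "W x1 = ys @ v # vs" and v: "\<And>z. z \<in> X \<Longrightarrow> v \<in> set (W z)"
    and first: "\<forall>y\<in>set ys. \<not> (\<forall>z\<in>X. y \<in> set (W z))"
    using split_list_first_prop[of "W x1" "\<lambda>v. \<forall>z\<in>X. v \<in> set (W z)"] by blast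
  \<comment> \<open>Were \<open>v\<close> in \<open>X\<close>, a displayed triple with
    \<open>v\<close> among its close leaves would have its two paths meeting in
    \<open>v\<close>.\<close>
  have "v \<notin> X"
  proof
    assume "v \<in> X"
    then obtain y z where yz: "y \<in> X" "z \<in> X" "displays T r v y z" using single by blast
    obtain p where p: "apath v p y" using tree_apath_exists[OF T verts verts] \<open>v \<in> X\<close> yz(1) by blast
    have "v \<in> set (pawalk_verts v p)" using hd_in_awalk_verts(2)[OF p] .
    moreover have "v \<in> set (pawalk_verts z (q z))" using v[OF yz(2)] unfolding W_def .
    ultimately show False using disj[OF yz(3) p q[OF yz(2)]] by blast
  qed
  \<comment> \<open>Being in the same component of the tree minus \<open>v\<close>.\<close>
  define joined where "joined x y \<longleftrightarrow> (\<exists>p. awalk x p y \<and> v \<notin> set (pawalk_verts x p))" for x y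
  have joined_sym: "joined y x" if "joined x y" for x y
    using that unfolding joined_def by (metis awalk_rev_path awalk_verts_rev_path set_rev)
  have joined_trans: "joined x z" if xy: "joined x y" and yz: "joined y z" for x y z
  proof -
    obtain p p' where p: "awalk x p y" "v \<notin> set (pawalk_verts x p)"
      and p': "awalk y p' z" "v \<notin> set (pawalk_verts y p')"
      using xy yz unfolding joined_def by blast
    have "v \<notin> set (pawalk_verts x (p @ p'))"
      using p p' by (simp add: set_awalk_verts_append)
    then show ?thesis using awalk_appendI[OF p(1) p'(1)] unfolding joined_def by blast
  qed
  have pred: "\<exists>u ws vs. joined z u \<and> (u, v) \<in> parcs T \<and> W z = ws @ v # vs \<and> u \<in> set ws"
    if z: "z \<in> X" for z
  proof -
    obtain p u vs where p: "awalk z p u" "(u, v) \<in> parcs T" "W z = pawalk_verts z p @ v # vs"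
      using apath_predecessor[OF T q[OF z], of v] v[OF z] z \<open>v \<notin> X\<close> unfolding W_def by blast
    have "distinct (W z)" using q[OF z] unfolding W_def apath_def by simp
    then have "v \<notin> set (pawalk_verts z p)" using p(3) by auto
    then have "joined z u" using p(1) unfolding joined_def by blast
    moreover have "u \<in> set (pawalk_verts z p)"
      by (rule end_in[OF p(1)])
    ultimately show ?thesis using p(2,3) by blast
  qed
  obtain u0 ws0 vs0 where u0: "joined x1 u0" "(u0, v) \<in> parcs T" "W x1 = ws0 @ v # vs0" "u0 \<in> set ws0"
    using pred[OF X(1)] by blast
  have "distinct (W x1)" using q[OF X(1)] unfolding W_def apath_def by simp
  then have "v \<notin> set ws0" "v \<notin> set vs0" unfolding u0(3) by auto
  \<comment> \<open>\<open>v\<close> occurs only once on \<open>W x1\<close>. So \<open>u0\<close>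
    comes before \<open>v\<close>, and by the choice of \<open>v\<close> some path to the root
    misses \<open>u0\<close>.\<close>
  then have "ws0 = ys" using append_Cons_eq_iff[of v ws0 vs0 ys vs] split u0(3) by simp
  then obtain z where z: "z \<in> X" "u0 \<notin> set (W z)" using first u0(4) by blast
  obtain u ws vs where u: "joined z u" "(u, v) \<in> parcs T" "W z = ws @ v # vs" "u \<in> set ws"
    using pred[OF z(1)] by blast
  have "\<not> joined x1 z"
  proof
    assume "joined x1 z"
    then have "joined u0 u" using u0(1) u(1) joined_sym joined_trans by metis
    then have "u0 = u"
      using tree_unique_exit[OF T arcs_symmetric[OF u0(2)] arcs_symmetric[OF u(2)]]
      unfolding joined_def by blast
    then show False using z(2) u(3,4) by auto
  qed
  have "joined x1 x1"
    unfolding joined_def using verts[OF X(1)] X(1) \<open>v \<notin> X\<close>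
    by (intro exI[of _ "[]"]) (auto simp: awalk_Nil_iff)
  then have "{y \<in> X. joined x1 y} \<noteq> {}" "{y \<in> X. joined x1 y} \<subset> X"
    using X(1) z(1) \<open>\<not> joined x1 z\<close> by auto
  from cross[OF this] obtain x y w where d: "x \<in> X" "joined x1 x" "y \<in> X" "\<not> joined x1 y" "w \<in> X"
    "displays T r x y w" by blast
  obtain p where p: "apath x p y" using tree_apath_exists[OF T verts verts] d(1,3) by blast
  \<comment> \<open>\<open>v\<close> lies on the path from \<open>w\<close> to the root, which the
    path from \<open>x\<close> to \<open>y\<close> must avoid.\<close>
  have "v \<notin> set (pawalk_verts x p)"
    using disj[OF d(6) p q[OF d(5)]] v[OF d(5)] unfolding W_def by blast
  then have "joined x y" using p unfolding joined_def apath_def by blast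
  then show False using d(2,4) joined_trans by blast
qed

section \<open>Displayed triples satisfy Aho's criterion\<close>

text \<open>Paths can be reversed. This justifies the encoding of triples, which identifies
  \<open>xy|z\<close> with \<open>yx|z\<close>.\<close>

lemma displays_commute: "displays T r x y z \<Longrightarrow> displays T r y x z" if "undirected_tree T"
proof -
  interpret pair_graph T using that unfolding undirected_tree_def by blast
  assume d: "displays T r x y z"
  have "set (pawalk_verts y p) \<inter> set (pawalk_verts z q) = {}" if "apath y p x" "apath z q r" for p q
  proof -
    have "apath x (rev_path p) y" using that(1) by simp
    then have "set (pawalk_verts x (rev_path p)) \<inter> set (pawalk_verts z q) = {}"
      using d that(2) unfolding displays_def awalk_verts_with_proj_eq by blast
    moreover have "pawalk_verts x (rev_path p) = rev (pawalk_verts y p)"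
      using that(1) by (intro awalk_verts_rev_path) (simp add: apath_def)
    ultimately show ?thesis by simp
  qed
  then show ?thesis using d unfolding displays_def awalk_verts_with_proj_eq by auto
qed

lemma displayed_triplesD:
  assumes "rooted_tree T r" "triple a b c \<in> displayed_triples T r"
  shows "displays T r (Inl a) (Inl b) (Inl c)"
proof -
  have "undirected_tree T" using assms(1) unfolding rooted_tree_def by blast
  then show ?thesis
    using assms(2) displays_commute[of T r] unfolding displayed_triples_def
    by (auto simp: doubleton_eq_iff)
qed

text \<open>The cut found by \<open>displays_separable\<close> among the tagged leaves is pulled
  back along \<open>Inl\<close>.\<close>

lemma aho_separable_displayed_triples:
  fixes T :: "'a tree_graph"
  assumes rt: "rooted_tree T r"
  shows "aho_separable (displayed_triples T r)"
  unfolding aho_separable_def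
proof (intro allI impI)
  fix L :: "'a set" assume "\<exists>x\<in>L. \<exists>y\<in>L. x \<noteq> y"
  then obtain x y where xy: "x \<in> L" "y \<in> L" "x \<noteq> y" by blast
  then have "Inl x \<in> (Inl ` L :: ('a + nat) set)" "Inl y \<in> (Inl ` L :: ('a + nat) set)"
    "Inl x \<noteq> (Inl y :: 'a + nat)" by simp_all
  from displays_separable[OF rt this]
  obtain P where P: "P \<noteq> {}" "P \<subset> Inl ` L"
    "\<forall>x\<in>P. \<forall>y\<in>Inl ` L - P. \<forall>z\<in>Inl ` L. \<not> displays T r x y z" by (elim exE conjE)
  show "separable (displayed_triples T r) L"
    unfolding separable_def
  proof (intro exI[of _ "{x \<in> L. Inl x \<in> P}"] conjI ballI)
    show "{x \<in> L. Inl x \<in> P} \<noteq> {}" "{x \<in> L. Inl x \<in> P} \<subset> L" using P(1,2) by auto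
    fix x y z assume *: "x \<in> {x \<in> L. Inl x \<in> P}" "y \<in> L - {x \<in> L. Inl x \<in> P}" "z \<in> L"
    have m: "Inl x \<in> P" "Inl y \<in> Inl ` L - P" "Inl z \<in> Inl ` L" using * by auto
    have "\<not> displays T r (Inl x) (Inl y) (Inl z)"
      by (rule P(3)[THEN bspec, THEN bspec, THEN bspec, OF m])
    then show "triple x y z \<notin> displayed_triples T r" using displayed_triplesD[OF rt] by blast
  qed
qed

section \<open>Trees from systems of clusters\<close>

text \<open>The vertex \<open>m\<close> is the only gate into \<open>D\<close>: some arc of the walk
  must enter \<open>D\<close>, and its head is \<open>m\<close>.\<close>

lemma walk_enters_through:
  assumes "pcas u p v" "set p \<subseteq> E" "u \<notin> D" "v \<in> D"
    and "\<And>a b. \<lbrakk>(b, a) \<in> E; a \<in> D; b \<notin> D\<rbrakk> \<Longrightarrow> a = m"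
  shows "m \<in> set (pawalk_verts u p)"
  using assms(1-4)
proof (induct p arbitrary: u)
  case (Cons e p)
  show ?case
  proof (cases "snd e \<in> D")
    case True
    then have "snd e = m" using Cons.prems assms(5)[of "fst e" "snd e"] by auto
    moreover have "snd e \<in> set (pawalk_verts (snd e) p)" using Cons.prems by (cases p) auto
    ultimately show ?thesis by simp
  next
    case False
    then show ?thesis using Cons by auto
  qed
qed simp

text \<open>By symmetry of \<open>E\<close> a walk also leaves \<open>D\<close> only through
  \<open>m\<close>. A path that left and came back would visit \<open>m\<close> twice.\<close>

lemma path_confined:
  assumes "pcas u p v" "set p \<subseteq> E" "distinct (pawalk_verts u p)" "sym E" "u \<in> D" "v \<in> D"
    and m: "\<And>a b. \<lbrakk>(b, a) \<in> E; a \<in> D; b \<notin> D\<rbrakk> \<Longrightarrow> a = m"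
  shows "set (pawalk_verts u p) \<subseteq> D"
  using assms(1-3,5,6)
proof (induct p arbitrary: u)
  case (Cons e p)
  have "snd e \<in> D"
  proof (rule ccontr)
    assume n: "snd e \<notin> D"
    have "(snd e, fst e) \<in> E" using Cons.prems(2) \<open>sym E\<close> by (auto simp: sym_def)
    then have "fst e = m" using m n Cons.prems by simp
    moreover have "m \<in> set (pawalk_verts (snd e) p)"
      by (rule walk_enters_through[OF _ _ n Cons.prems(5) m]) (use Cons.prems in auto)
    ultimately show False using Cons.prems by auto
  qed
  then show ?case using Cons by auto
qed simp

lemma pcas_last: "pcas u p v \<Longrightarrow> p \<noteq> [] \<Longrightarrow> snd (last p) = v"
  by (induct p arbitrary: u) auto

lemma pcas_append: "pcas u (p @ q) w \<longleftrightarrow> (\<exists>v. pcas u p v \<and> pcas v q w)"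
  by (induct p arbitrary: u) auto

text \<open>The closed walk is rotated so that it starts and ends in \<open>m\<close>. Its first
  head and its last tail are the required neighbours; length at least 3 and distinct heads make them
  differ.\<close>

lemma closed_walk_neighbours:
  assumes "pcas u p u" "distinct (map snd p)" "3 \<le> length p" "m \<in> snd ` set p"
  shows "\<exists>x y. x \<in> snd ` set p \<and> y \<in> snd ` set p \<and> x \<noteq> y \<and> (x, m) \<in> set p \<and> (m, y) \<in> set p"
proof -
  obtain x where "(x, m) \<in> set p" using assms(4) by force
  then obtain p1 p2 where p: "p = p1 @ (x, m) # p2" by (meson split_list)
  define c where "c = p2 @ p1"
  have c: "pcas m (c @ [(x, m)]) m" "set p = set (c @ [(x, m)])" "distinct (map snd (c @ [(x, m)]))"
    "length p = length (c @ [(x, m)])"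
    using assms(1,2) unfolding p c_def by (auto simp: pcas_append)
  then obtain f d where f: "c = f # d" "d \<noteq> []"
    using assms(3) by (cases c; cases "tl c") auto
  then have fm: "fst f = m" "snd (last d) = x"
    using c(1) pcas_last by (auto simp: pcas_append)
  have "last d \<in> set d" using f(2) by simp
  then have x: "x \<in> snd ` set d" unfolding fm(2)[symmetric] by (rule imageI)
  moreover have "snd f \<notin> snd ` set d" using c(3) f(1) by simp
  ultimately have "x \<noteq> snd f" by metis
  moreover have "x \<in> snd ` set p" using x c(2) f(1) by auto
  moreover have "(m, snd f) \<in> set p" using c(2) f(1) fm by (cases f) auto
  moreover have "snd f \<in> snd ` set p" "(x, m) \<in> set p" using c(2) f(1) by auto
  ultimately show ?thesis by blast
qed

section \<open>The tree of a laminar family\<close>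

text \<open>\<open>C v\<close> is to be the set of leaves below \<open>v\<close>. Vertices are kept
  apart from clusters because the final tree must have vertices of type
  \<open>'a + nat\<close>.\<close>

locale cluster_system =
  fixes V :: "'v set" and C :: "'v \<Rightarrow> 'a set" and r :: 'v and L :: "'a set" and leaf :: "'a \<Rightarrow> 'v"
  assumes finite_V: "finite V"
    and inj_C: "inj_on C V"
    and nonempty: "v \<in> V \<Longrightarrow> C v \<noteq> {}"
    and laminar: "\<lbrakk>u \<in> V; w \<in> V; C u \<inter> C w \<noteq> {}\<rbrakk> \<Longrightarrow> C u \<subseteq> C w \<or> C w \<subseteq> C u"
    and root: "r \<in> V" "C r = L"
    and cluster_sub: "v \<in> V \<Longrightarrow> C v \<subseteq> L"
    and leaf: "x \<in> L \<Longrightarrow> leaf x \<in> V" "x \<in> L \<Longrightarrow> C (leaf x) = {x}"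
    and two: "\<exists>x\<in>L. \<exists>y\<in>L. x \<noteq> y"
begin

text \<open>The arguments run from child to parent: \<open>u\<close> is a child of \<open>w\<close>
  in the Hasse diagram of the clusters.\<close>

definition covers :: "'v \<Rightarrow> 'v \<Rightarrow> bool" where
  "covers u w \<longleftrightarrow> u \<in> V \<and> w \<in> V \<and> C u \<subset> C w \<and> \<not> (\<exists>x\<in>V. C u \<subset> C x \<and> C x \<subset> C w)"

definition T :: "'v pair_pre_digraph" where
  "T = \<lparr>pverts = V, parcs = {(u, w). covers u w \<or> covers w u}\<rparr>"

lemma T_simps [simp]: "pverts T = V" "parcs T = {(u, w). covers u w \<or> covers w u}"
  by (simp_all add: T_def)

lemma C_eqD: "u \<in> V \<Longrightarrow> w \<in> V \<Longrightarrow> C u = C w \<Longrightarrow> u = w"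
  using inj_C by (rule inj_onD)

lemma coversD: assumes "covers u w" shows "u \<in> V" "w \<in> V" "C u \<subset> C w"
  using assms unfolding covers_def by simp_all

lemma covers_between: "covers u w \<Longrightarrow> x \<in> V \<Longrightarrow> C u \<subset> C x \<Longrightarrow> C x \<subseteq> C w \<Longrightarrow> x = w"
  unfolding covers_def using C_eqD by (metis psubsetI)

text \<open>Both parent clusters contain the nonempty \<open>C u\<close>, so they are comparable by
  laminarity, and neither can lie strictly between \<open>C u\<close> and the other.\<close>

lemma covers_unique: assumes "covers u w" "covers u w'" shows "w = w'"
proof -
  have "C u \<subseteq> C w \<inter> C w'" "C u \<noteq> {}" using coversD[OF assms(1)] coversD[OF assms(2)] nonempty by auto
  then consider "C w \<subseteq> C w'" | "C w' \<subseteq> C w"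
    using laminar coversD(2) assms by blast
  then show ?thesis
    using covers_between assms coversD by cases metis+
qed

lemma cover_above:
  assumes "u \<in> V" "w \<in> V" "C u \<subset> C w" shows "\<exists>x. covers u x"
proof -
  let ?F = "C ` {x \<in> V. C u \<subset> C x}"
  have "finite ?F" "?F \<noteq> {}" using finite_V assms by auto
  from finite_has_minimal[OF this]
  obtain X where X: "X \<in> ?F" "\<forall>Y\<in>?F. Y \<subseteq> X \<longrightarrow> X = Y" by (elim bexE)
  then obtain x where x: "x \<in> V" "C u \<subset> C x" "X = C x" by blast
  have "\<not> (\<exists>y\<in>V. C u \<subset> C y \<and> C y \<subset> C x)"
  proof
    assume "\<exists>y\<in>V. C u \<subset> C y \<and> C y \<subset> C x"
    then obtain y where y: "y \<in> V" "C u \<subset> C y" "C y \<subset> C x" by blast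
    then have "C y \<in> ?F" by blast
    from X(2)[THEN bspec, OF this] y(3) x(3) show False by blast
  qed
  then show ?thesis using x assms(1) unfolding covers_def by blast
qed

lemma cover_below:
  assumes "u \<in> V" "w \<in> V" "C u \<subset> C w" shows "\<exists>x. covers x w \<and> C u \<subseteq> C x"
proof -
  let ?F = "C ` {x \<in> V. C u \<subseteq> C x \<and> C x \<subset> C w}"
  have "finite ?F" "?F \<noteq> {}" using finite_V assms by auto
  from finite_has_maximal[OF this]
  obtain X where X: "X \<in> ?F" "\<forall>Y\<in>?F. X \<subseteq> Y \<longrightarrow> X = Y" by (elim bexE)
  then obtain x where x: "x \<in> V" "C u \<subseteq> C x" "C x \<subset> C w" "X = C x" by blast
  have "\<not> (\<exists>y\<in>V. C x \<subset> C y \<and> C y \<subset> C w)"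
  proof
    assume "\<exists>y\<in>V. C x \<subset> C y \<and> C y \<subset> C w"
    then obtain y where y: "y \<in> V" "C x \<subset> C y" "C y \<subset> C w" by blast
    then have "C y \<in> ?F" using x(2) by auto
    from X(2)[THEN bspec, OF this] y(2) x(4) show False by blast
  qed
  then show ?thesis using x assms(2) unfolding covers_def by blast
qed

lemma sym_arcs: "sym (parcs T)"
  by (auto simp: sym_def)

lemma pair_graph_T: "pair_graph T"
proof -
  have "parcs T \<subseteq> V \<times> V" using coversD by auto
  then have fin: "finite (parcs T)" using finite_V finite_subset by blast
  show ?thesis
  proof
    show "fst e \<in> pverts T" "snd e \<in> pverts T" "fst e \<noteq> snd e" if "e \<in> parcs T" for e
      using that by (auto dest: coversD)
    show "finite (pverts T)" "finite (parcs T)" using finite_V fin by simp_all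
    show "symmetric (with_proj T)" using sym_arcs by (simp add: symmetric_def)
  qed
qed

lemma reaches_root: "v \<in> V \<Longrightarrow> reachable (with_proj T) v r"
proof (induct "card L - card (C v)" arbitrary: v rule: less_induct)
  case less
  interpret pair_graph T by (rule pair_graph_T)
  show ?case
  proof (cases "v = r")
    case True
    then show ?thesis using less by (auto intro: reachable_refl)
  next
    case False
    then have "C v \<subset> C r" using C_eqD root cluster_sub less.prems by blast
    then obtain x where x: "covers v x" using cover_above root less.prems by blast
    \<comment> \<open>\<open>leaf\<close> embeds \<open>L\<close> into the finite set
      \<open>V\<close>, as distinct singletons belong to distinct vertices.\<close>
    have "finite L" using finite_V leaf inj_C
      by (metis finite_imageD finite_subset image_subsetI inj_on_def singleton_inject)
    then have "card (C v) < card (C x)" "card (C x) \<le> card L"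
      using coversD[OF x] cluster_sub by (auto intro!: psubset_card_mono card_mono dest: finite_subset)
    then have "reachable (with_proj T) x r" using less.hyps[of x] coversD[OF x] by simp
    moreover have "(v, x) \<in> parcs T" using x by simp
    ultimately show ?thesis by (auto intro: adj_reachable_trans)
  qed
qed

text \<open>Every vertex reaches the root, which gives connectedness. On a cycle, both neighbours of
  a vertex with inclusion-minimal cluster would be parents of it, against
  \<open>covers_unique\<close>.\<close>

lemma undirected_tree_T: "undirected_tree T"
  unfolding undirected_tree_def
proof (intro conjI notI pair_graph_T)
  interpret pair_graph T by (rule pair_graph_T)
  have "(u, v) \<in> rtrancl_on V ((parcs T)\<^sup>s)" if "u \<in> V" "v \<in> V" for u v
  proof -
    have "reachable (with_proj T) u v"
      using reaches_root that symmetric_reachable' reachable_trans by metis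
    then have "(u, v) \<in> rtrancl_on V (parcs T)" by (simp add: reachable_def)
    then show ?thesis by (rule rtrancl_on_mono[rotated 2]) (simp_all add: symcl_def)
  qed
  then show "Digraph_Component.connected (with_proj T)"
    unfolding connected_conv with_proj_simps using root(1) by auto
next
  assume "\<exists>p. pre_digraph.cycle (with_proj T) p \<and> 3 \<le> length p"
  then obtain p u where "pre_digraph.cycle (with_proj T) p" and len: "3 \<le> length p" by blast
  then obtain u where aw: "pre_digraph.awalk (with_proj T) u p u"
      and d: "distinct (tl (pawalk_verts u p))"
    unfolding pre_digraph.cycle_def awalk_verts_with_proj_eq by blast
  have p: "pcas u p u" "set p \<subseteq> parcs T" using aw
    unfolding pre_digraph.awalk_def cas_with_proj_eq by auto
  have tl: "tl (pawalk_verts w q) = map snd q" if "pcas w q v" for w q v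
    using that
  proof (induct q arbitrary: w)
    case (Cons e q)
    then show ?case by (cases q) auto
  qed simp
  have d: "distinct (map snd p)" using d unfolding tl[OF p(1)] .
  have "finite (C ` snd ` set p)" "C ` snd ` set p \<noteq> {}" using len by auto
  from finite_has_minimal[OF this]
  obtain X where X: "X \<in> C ` snd ` set p" "\<forall>Y\<in>C ` snd ` set p. Y \<subseteq> X \<longrightarrow> X = Y" by (elim bexE)
  obtain m where m: "m \<in> snd ` set p" and Xm: "X = C m" using X(1) by blast
  have min: "\<not> C y \<subset> C m" if "y \<in> snd ` set p" for y
    using X(2) that unfolding Xm by auto
  obtain x y where xy: "x \<in> snd ` set p" "y \<in> snd ` set p" "x \<noteq> y" "(x, m) \<in> set p" "(m, y) \<in> set p"
    using closed_walk_neighbours[OF p(1) d len m] by blast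
  have "covers m x" using p(2) xy(4) min[OF xy(1)] coversD by fastforce
  moreover have "covers m y" using p(2) xy(5) min[OF xy(2)] coversD by fastforce
  ultimately show False using covers_unique xy(3) by blast
qed

lemma out_degree_T: "out_degree (with_proj T) v = card {w. covers v w \<or> covers w v}"
proof -
  have "out_arcs (with_proj T) v = Pair v ` {w. covers v w \<or> covers w v}"
    by (auto simp: out_arcs_def)
  then show ?thesis unfolding out_degree_def by (simp add: card_image inj_on_def)
qed

lemma finite_neighbours: "finite {w. covers v w \<or> covers w v}"
  by (rule finite_subset[OF _ finite_V]) (auto dest: coversD)

lemma has_parent: assumes "v \<in> V" "v \<noteq> r" shows "\<exists>x. covers v x"
proof -
  have "C v \<noteq> C r" using C_eqD assms root by blast
  then have "C v \<subset> C r" using cluster_sub[OF assms(1)] root by blast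
  then show ?thesis using cover_above assms root by blast
qed

lemma leaf_degree: assumes "x \<in> L" shows "out_degree (with_proj T) (leaf x) = 1"
proof -
  have "C (leaf x) \<noteq> C r" using leaf[OF assms] root two by auto
  then obtain w where w: "covers (leaf x) w" using has_parent[of "leaf x"] leaf[OF assms] by blast
  moreover have "\<not> covers u (leaf x)" for u
    using coversD[of u "leaf x"] nonempty leaf(2)[OF assms] by auto
  ultimately have "{u. covers (leaf x) u \<or> covers u (leaf x)} = {w}" using covers_unique by blast
  then show ?thesis unfolding out_degree_T by simp
qed

text \<open>A child has a strictly smaller cluster, so it misses a point of \<open>C v\<close>; that
  point lies in another child.\<close>

lemma two_children:
  assumes v: "v \<in> V" "v \<notin> leaf ` L"
  shows "\<exists>k k'. covers k v \<and> covers k' v \<and> k \<noteq> k'"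
proof -
  have sing: "C v \<noteq> {x}" for x
  proof
    assume "C v = {x}"
    then have "x \<in> L" using cluster_sub v(1) by blast
    then show False using C_eqD[OF v(1)] leaf \<open>C v = {x}\<close> v(2) by blast
  qed
  have child: "\<exists>k. covers k v \<and> x \<in> C k" if "x \<in> C v" for x
  proof -
    have "x \<in> L" using that cluster_sub v(1) by blast
    moreover have "{x} \<subset> C v" using that sing by blast
    ultimately show ?thesis using cover_below[of "leaf x" v] leaf v(1) by auto
  qed
  obtain x where x: "x \<in> C v" using nonempty v(1) by blast
  obtain k where k: "covers k v" "x \<in> C k" using child[OF x] by blast
  then obtain y where y: "y \<in> C v" "y \<notin> C k" using coversD[OF k(1)] by blast
  obtain k' where "covers k' v" "y \<in> C k'" using child[OF y(1)] by blast
  then show ?thesis using k y by blast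
qed

lemma inner_degree:
  assumes v: "v \<in> V" "v \<notin> leaf ` L"
  shows "2 \<le> out_degree (with_proj T) v" "v \<noteq> r \<Longrightarrow> 3 \<le> out_degree (with_proj T) v"
proof -
  obtain k k' where k: "covers k v" "covers k' v" "k \<noteq> k'" using two_children[OF v] by blast
  have "card {k, k'} \<le> out_degree (with_proj T) v"
    unfolding out_degree_T by (rule card_mono[OF finite_neighbours]) (use k in auto)
  then show "2 \<le> out_degree (with_proj T) v" using k(3) by simp
  assume "v \<noteq> r"
  then obtain p where p: "covers v p" using has_parent v by blast
  have "p \<noteq> k" "p \<noteq> k'" using coversD[OF p] coversD[OF k(1)] coversD[OF k(2)] by auto
  then have "card {k, k', p} = 3" using k(3) by simp
  moreover have "card {k, k', p} \<le> out_degree (with_proj T) v"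
    unfolding out_degree_T by (rule card_mono[OF finite_neighbours]) (use k p in auto)
  ultimately show "3 \<le> out_degree (with_proj T) v" by simp
qed

lemma leaves_T: "leaves T = leaf ` L"
proof
  show "leaves T \<subseteq> leaf ` L"
  proof
    fix v assume "v \<in> leaves T"
    then have "v \<in> V" "out_degree (with_proj T) v = 1" unfolding leaves_def by auto
    then show "v \<in> leaf ` L" using inner_degree(1)[of v] by fastforce
  qed
  show "leaf ` L \<subseteq> leaves T" unfolding leaves_def using leaf_degree leaf(1) by auto
qed

lemma root_not_leaf: "r \<notin> leaf ` L"
  using leaf(2) root two by fastforce

lemma rooted_tree_T: "rooted_tree T r"
  unfolding rooted_tree_def inner_vertices_def leaves_T
  using undirected_tree_T root(1) root_not_leaf inner_degree by auto

text \<open>The only edge between the vertices below \<open>M\<close> and the rest joins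
  \<open>M\<close> to its parent. Hence the path from \<open>x\<close> to \<open>y\<close> stays
  below \<open>M\<close>, and the path from \<open>z\<close> to the root stays outside.\<close>

lemma displays_T:
  assumes xyz: "x \<in> L" "y \<in> L" "z \<in> L" "distinct [x, y, z]"
    and M: "M \<in> V" "x \<in> C M" "y \<in> C M" "z \<notin> C M"
  shows "displays T r (leaf x) (leaf y) (leaf z)"
proof -
  define D where "D = {v \<in> V. C v \<subseteq> C M}"
  have exit: "covers a b \<and> a = M" if "(b, a) \<in> parcs T" "a \<in> D" "b \<notin> D" for a b
  proof -
    have a: "a \<in> V" "C a \<subseteq> C M" using that(2) unfolding D_def by auto
    have "\<not> covers b a" using that(3) a coversD unfolding D_def by fastforce
    then have ab: "covers a b" using that(1) by simp
    note ab' = coversD[OF ab]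
    have "C b \<inter> C M \<noteq> {}" using ab' a nonempty by blast
    then have "C M \<subset> C b" using laminar[of b M] ab' M(1) that(3) unfolding D_def by blast
    then have "\<not> C a \<subset> C M" using ab M(1) unfolding covers_def by blast
    then show ?thesis using ab a C_eqD M(1) by blast
  qed
  have "M \<noteq> r" using M(4) xyz(3) root by auto
  then obtain P where P: "covers M P" using has_parent M(1) by blast
  have inD: "leaf x \<in> D" "leaf y \<in> D" using leaf xyz M unfolding D_def by auto
  have notD: "leaf z \<in> - D" "r \<in> - D" using leaf xyz M root unfolding D_def by auto
  have inj: "leaf u \<noteq> leaf w" if "u \<in> L" "w \<in> L" "u \<noteq> w" for u w
    using leaf(2)[OF that(1)] leaf(2)[OF that(2)] that(3) by auto
  have "set (pawalk_verts (leaf x) p) \<inter> set (pawalk_verts (leaf z) q) = {}"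
    if "pre_digraph.apath (with_proj T) (leaf x) p (leaf y)" "pre_digraph.apath (with_proj T) (leaf z) q r"
    for p q
  proof -
    have p: "pcas (leaf x) p (leaf y)" "set p \<subseteq> parcs T" "distinct (pawalk_verts (leaf x) p)"
      and q: "pcas (leaf z) q r" "set q \<subseteq> parcs T" "distinct (pawalk_verts (leaf z) q)"
      using that unfolding pre_digraph.apath_def pre_digraph.awalk_def
        awalk_verts_with_proj_eq cas_with_proj_eq by simp_all
    have "set (pawalk_verts (leaf x) p) \<subseteq> D"
      by (rule path_confined[OF p sym_arcs inD, of M]) (use exit in blast)
    moreover have "set (pawalk_verts (leaf z) q) \<subseteq> - D"
    \<comment> \<open>Seen from the complement of \<open>D\<close>, the gate is the parent
      \<open>P\<close> of \<open>M\<close>.\<close>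
    proof (rule path_confined[OF q sym_arcs notD, of P])
      fix a b assume "(b, a) \<in> parcs T" "a \<in> - D" "b \<notin> - D"
      then have "covers b a \<and> b = M" using exit[of a b] sym_arcs by (auto simp: sym_def)
      then show "a = P" using P covers_unique by blast
    qed
    ultimately show ?thesis by blast
  qed
  then show ?thesis
    unfolding displays_def leaves_T awalk_verts_with_proj_eq using xyz inj by auto
qed

end

section \<open>Building a tree from Aho's criterion\<close>

text \<open>Aho's recursion: a cut splits \<open>L\<close> into \<open>P\<close> and
  \<open>L - P\<close>, whose hierarchies are joined below \<open>L\<close>. The close leaves of a
  triple are never cut apart; if the third leaf lies on the other side, their side is the cluster
  \<open>M\<close>.\<close>

lemma hierarchy_exists:
  assumes aho: "aho_separable S" and tr: "triple_set S" and "finite L" "L \<noteq> {}"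
  shows "\<exists>H. H \<subseteq> Pow L \<and> L \<in> H \<and> {} \<notin> H \<and> (\<forall>x\<in>L. {x} \<in> H) \<and>
    (\<forall>A\<in>H. \<forall>B\<in>H. A \<inter> B \<noteq> {} \<longrightarrow> A \<subseteq> B \<or> B \<subseteq> A) \<and>
    (\<forall>x\<in>L. \<forall>y\<in>L. \<forall>z\<in>L. triple x y z \<in> S \<longrightarrow> (\<exists>M\<in>H. x \<in> M \<and> y \<in> M \<and> z \<notin> M))"
  using assms(3,4)
proof (induct L rule: finite_psubset_induct)
  case (psubset L)
  show ?case
  proof (cases "\<exists>x\<in>L. \<exists>y\<in>L. x \<noteq> y")
    case False
    then obtain a where L: "L = {a}" using psubset.prems by auto
    \<comment> \<open>On a single leaf this is the only triple to be excluded.\<close>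
    have "triple a a a \<notin> S" using tr unfolding triple_set_def by auto
    then show ?thesis unfolding L by (intro exI[of _ "{{a}}"]) auto
  next
    case True
    then obtain P where P: "P \<noteq> {}" "P \<subset> L" "\<forall>x\<in>P. \<forall>y\<in>L - P. \<forall>z\<in>L. triple x y z \<notin> S"
      using aho unfolding aho_separable_def separable_def by meson
    let ?Q = "L - P"
    obtain H where H: "H \<subseteq> Pow P" "P \<in> H" "{} \<notin> H" "\<forall>x\<in>P. {x} \<in> H"
      "\<forall>A\<in>H. \<forall>B\<in>H. A \<inter> B \<noteq> {} \<longrightarrow> A \<subseteq> B \<or> B \<subseteq> A"
      "\<forall>x\<in>P. \<forall>y\<in>P. \<forall>z\<in>P. triple x y z \<in> S \<longrightarrow> (\<exists>M\<in>H. x \<in> M \<and> y \<in> M \<and> z \<notin> M)"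
      using psubset.hyps(2)[OF P(2,1)] by (elim exE conjE)
    have Q: "?Q \<subset> L" "?Q \<noteq> {}" using P by auto
    obtain K where K: "K \<subseteq> Pow ?Q" "?Q \<in> K" "{} \<notin> K" "\<forall>x\<in>?Q. {x} \<in> K"
      "\<forall>A\<in>K. \<forall>B\<in>K. A \<inter> B \<noteq> {} \<longrightarrow> A \<subseteq> B \<or> B \<subseteq> A"
      "\<forall>x\<in>?Q. \<forall>y\<in>?Q. \<forall>z\<in>?Q. triple x y z \<in> S \<longrightarrow> (\<exists>M\<in>K. x \<in> M \<and> y \<in> M \<and> z \<notin> M)"
      using psubset.hyps(2)[OF Q] by (elim exE conjE)
    have sub: "A \<subseteq> P" if "A \<in> H" for A using that H(1) by blast
    have subK: "A \<subseteq> ?Q" if "A \<in> K" for A using that K(1) by blast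
    have HK: "A \<inter> B = {}" if "A \<in> H" "B \<in> K" for A B using sub[OF that(1)] subK[OF that(2)] by blast
    show ?thesis
    proof (intro exI[of _ "insert L (H \<union> K)"] conjI ballI impI)
      show "insert L (H \<union> K) \<subseteq> Pow L" using H(1) K(1) P(2) by auto
      show "{} \<notin> insert L (H \<union> K)" using H(3) K(3) psubset.prems by auto
      show "{x} \<in> insert L (H \<union> K)" if "x \<in> L" for x using that H(4) K(4) by auto
      show "A \<subseteq> B \<or> B \<subseteq> A" if A: "A \<in> insert L (H \<union> K)" and B: "B \<in> insert L (H \<union> K)"
        and ne: "A \<inter> B \<noteq> {}" for A B
      proof -
        have "A \<subseteq> L" "B \<subseteq> L" using A B sub subK P(2) by auto
        then consider "A = L \<or> B = L" | "A \<in> H" "B \<in> H" | "A \<in> K" "B \<in> K" | "A \<in> H" "B \<in> K"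
          | "A \<in> K" "B \<in> H" using A B by blast
        then show ?thesis
        proof cases
          case 1 then show ?thesis using \<open>A \<subseteq> L\<close> \<open>B \<subseteq> L\<close> by auto
        next
          case 2 then show ?thesis using H(5) ne by simp
        next
          case 3 then show ?thesis using K(5) ne by simp
        next
          case 4 then show ?thesis using HK ne by simp
        next
          case 5 then show ?thesis using HK[of B A] ne by (simp add: Int_commute)
        qed
      qed
      show "\<exists>M\<in>insert L (H \<union> K). x \<in> M \<and> y \<in> M \<and> z \<notin> M"
        if "x \<in> L" "y \<in> L" "z \<in> L" and t: "triple x y z \<in> S" for x y z
      proof (cases "x \<in> P")
        case True
        then have y: "y \<in> P" using P(3) that by blast
        show ?thesis
        proof (cases "z \<in> P")
          case True
          then have "\<exists>M\<in>H. x \<in> M \<and> y \<in> M \<and> z \<notin> M" using H(6) \<open>x \<in> P\<close> y t by simp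
          then show ?thesis by blast
        next
          case False
          then show ?thesis using \<open>x \<in> P\<close> y H(2) by (intro bexI[of _ P]) simp_all
        qed
      next
        case False
        \<comment> \<open>The cut forbids triples from \<open>P\<close> to its complement, so the
          two close leaves are swapped.\<close>
        have "triple y x z \<in> S" using t by (simp add: insert_commute)
        then have y: "y \<in> ?Q" using P(3) False that(1-3) by blast
        have x: "x \<in> ?Q" using False that(1) by simp
        show ?thesis
        proof (cases "z \<in> P")
          case True
          then show ?thesis using x y K(2) by (intro bexI[of _ "L - P"]) simp_all
        next
          case False
          then have "\<exists>M\<in>K. x \<in> M \<and> y \<in> M \<and> z \<notin> M" using K(6) x y t that(3) by simp
          then show ?thesis by blast
        qed
      qed
    qed simp
  qed
qed

lemma leaf_setI:
  assumes "triple a b c \<in> S"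
  shows "a \<in> leaf_set S" "b \<in> leaf_set S" "c \<in> leaf_set S"
  using UN_upper[OF assms, of "\<lambda>(p, c). insert c p"] unfolding leaf_set_def by simp_all

text \<open>The hierarchy is realised as a cluster system. The leaf set of the tree is exactly
  \<open>leaf_set S\<close>, so the tree is one of those that define \<open>cl S\<close>.\<close>

lemma aho_separable_tree:
  assumes aho: "aho_separable S" and tr: "triple_set S" and fin: "finite (leaf_set S)"
  shows "\<exists>T r. rooted_tree_on (leaf_set S) T r \<and> S \<subseteq> displayed_triples T r"
proof (cases "S = {}")
  case True
  \<comment> \<open>A cluster system has at least two leaves, so the empty triple set gets the
    one-vertex tree.\<close>
  let ?T = "\<lparr>pverts = {Inr 0}, parcs = {}\<rparr> :: 'a tree_graph"
  have deg: "out_degree (with_proj ?T) v = 0" for v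
    by (simp add: out_degree_def out_arcs_def)
  interpret pair_graph ?T
    by unfold_locales (auto simp: symmetric_def sym_def)
  have "Digraph_Component.connected (with_proj ?T)"
    unfolding connected_conv by simp
  moreover have "p = []" if "cycle p" for p
    using that unfolding cycle_def awalk_def by auto
  moreover have "pair_graph ?T" ..
  ultimately have "undirected_tree ?T" unfolding undirected_tree_def by fastforce
  moreover have "leaves ?T = {}" unfolding leaves_def deg by simp
  ultimately have "rooted_tree_on (leaf_set S) ?T (Inr 0)"
    unfolding rooted_tree_on_def rooted_tree_def inner_vertices_def True leaf_set_def by simp
  then show ?thesis using True by blast
next
  case False
  let ?L = "leaf_set S"
  obtain a b c where abc: "triple a b c \<in> S" "distinct [a, b, c]"
    using False tr unfolding triple_set_def by blast
  then have L: "a \<in> ?L" "b \<in> ?L" "a \<noteq> b" using leaf_setI[OF abc(1)] by simp_all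
  then have "?L \<noteq> {}" by auto
  from hierarchy_exists[OF aho tr fin this]
  obtain H where H: "H \<subseteq> Pow ?L" "?L \<in> H" "{} \<notin> H" "\<forall>x\<in>?L. {x} \<in> H"
      "\<forall>A\<in>H. \<forall>B\<in>H. A \<inter> B \<noteq> {} \<longrightarrow> A \<subseteq> B \<or> B \<subseteq> A"
      "\<forall>x\<in>?L. \<forall>y\<in>?L. \<forall>z\<in>?L. triple x y z \<in> S \<longrightarrow> (\<exists>M\<in>H. x \<in> M \<and> y \<in> M \<and> z \<notin> M)"
    by (elim exE conjE)
  \<comment> \<open>Singletons become the leaves \<open>Inl x\<close>; the remaining clusters become
    inner vertices, numbered by \<open>g\<close>.\<close>
  define I where "I = {A \<in> H. \<not> (\<exists>x. A = {x})}"
  have "finite H" using H(1) fin finite_subset by blast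
  then have "finite I" unfolding I_def by simp
  then obtain g :: "'a set \<Rightarrow> nat" where g: "inj_on g I" using finite_imp_inj_to_nat_seg by metis
  define C where "C = case_sum (\<lambda>x. {x}) (inv_into I g)"
  define V where "V = Inl ` ?L \<union> Inr ` g ` I"
  have C: "C (Inl x) = {x}" "A \<in> I \<Longrightarrow> C (Inr (g A)) = A" for x :: 'a and A
    unfolding C_def using g by (simp_all add: inv_into_f_f)
  have V: "v \<in> V \<longleftrightarrow> (\<exists>x\<in>?L. v = Inl x) \<or> (\<exists>A\<in>I. v = Inr (g A))" for v unfolding V_def by auto
  have CH: "C v \<in> H" if "v \<in> V" for v using that C H(4) unfolding V I_def by auto
  have HC: "\<exists>v\<in>V. C v = A" if "A \<in> H" for A
  proof (cases "\<exists>x. A = {x}")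
    case True
    then obtain x where x: "A = {x}" by (elim exE)
    then have "x \<in> ?L" using that H(1) by auto
    then have "Inl x \<in> V" unfolding V by simp
    then show ?thesis using x C(1) by (intro bexI[of _ "Inl x"]) simp_all
  next
    case False
    then have "A \<in> I" using that unfolding I_def by simp
    moreover from this have "Inr (g A) \<in> V" unfolding V by auto
    ultimately show ?thesis using C(2) by (intro bexI[of _ "Inr (g A)"]) simp_all
  qed
  have LI: "?L \<in> I" using H(2) L unfolding I_def by auto
  interpret cluster_system V C "Inr (g ?L)" ?L Inl
  proof
    show "finite V" unfolding V_def using fin \<open>finite I\<close> by simp
    show "inj_on C V"
    proof (rule inj_onI)
      fix u w assume "u \<in> V" "w \<in> V" "C u = C w"
      then show "u = w" unfolding V using C by (auto simp: I_def)
    qed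
    show "C v \<noteq> {}" if "v \<in> V" for v using CH[OF that] H(3) by auto
    show "C u \<subseteq> C w \<or> C w \<subseteq> C u" if "u \<in> V" "w \<in> V" "C u \<inter> C w \<noteq> {}" for u w
      using H(5) CH that by blast
    show "Inr (g ?L) \<in> V" "C (Inr (g ?L)) = ?L" using LI C(2) unfolding V by auto
    show "C v \<subseteq> ?L" if "v \<in> V" for v using CH[OF that] H(1) by auto
    show "Inl x \<in> V" "C (Inl x) = {x}" if "x \<in> ?L" for x using that C V by auto
    show "\<exists>x\<in>?L. \<exists>y\<in>?L. x \<noteq> y" using L by blast
  qed
  have "rooted_tree_on ?L T (Inr (g ?L))"
    unfolding rooted_tree_on_def using rooted_tree_T leaves_T by simp
  moreover have "S \<subseteq> displayed_triples T (Inr (g ?L))"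
  proof
    fix t assume t: "t \<in> S"
    then obtain x y z where xyz: "t = triple x y z" "distinct [x, y, z]"
      using tr unfolding triple_set_def by blast
    then have in_L: "x \<in> ?L" "y \<in> ?L" "z \<in> ?L" using leaf_setI t by simp_all
    then obtain M where "M \<in> H" "x \<in> M" "y \<in> M" "z \<notin> M" using H(6) t xyz(1) by blast
    moreover then obtain v where "v \<in> V" "C v = M" using HC by blast
    ultimately have "displays T (Inr (g ?L)) (Inl x) (Inl y) (Inl z)"
      using displays_T[OF in_L xyz(2), of v] by simp
    then show "t \<in> displayed_triples T (Inr (g ?L))" unfolding displayed_triples_def xyz(1) by blast
  qed
  ultimately show ?thesis by blast
qed

section \<open>Closure and pairs of components\<close>

lemma leaf_set_mono: "S \<subseteq> S' \<Longrightarrow> leaf_set S \<subseteq> leaf_set S'"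
  unfolding leaf_set_def by (rule UN_mono) auto

lemma leaf_set_least: "(\<And>p c. (p, c) \<in> S \<Longrightarrow> insert c p \<subseteq> X) \<Longrightarrow> leaf_set S \<subseteq> X"
  unfolding leaf_set_def by (rule UN_least) (auto split: prod.splits)

lemma linked_leaf_set:
  assumes "linked S L x y" "x \<in> leaf_set S" shows "y \<in> leaf_set S"
  by (rule linked_invariant[OF assms]) (rule leaf_setI)

text \<open>
  The new triple adds just the edge from \<open>a\<close> to \<open>c\<close>; if that connects an Ahograph,
  it joined exactly two components before.
\<close>

lemma not_aho_separable_insert:
  assumes aho: "aho_separable S" and leafs: "a \<in> leaf_set S" "c \<in> leaf_set S"
    and not_aho: "\<not> aho_separable (insert (triple a c b) S)"
  shows "\<exists>A B. component_split S a a c A B \<and> b \<in> A \<union> B"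
proof -
  let ?S = "insert (triple a c b) S"
  obtain L where two: "\<exists>x\<in>L. \<exists>y\<in>L. x \<noteq> y" and ns: "\<not> separable ?S L"
    using not_aho unfolding aho_separable_def by blast
  have sep: "separable S L" using aho two unfolding aho_separable_def by blast
  have linked: "linked ?S L x y" if "x \<in> L" "y \<in> L" for x y
    using ns that separableI by metis
  \<comment> \<open>If one of the three were missing, the new triple would give no edge on
    \<open>L\<close>, and the old graph would already be connected.\<close>
  have in_L: "a \<in> L \<and> b \<in> L \<and> c \<in> L"
  proof (rule ccontr)
    assume n: "\<not> (a \<in> L \<and> b \<in> L \<and> c \<in> L)"
    obtain x y where xy: "x \<in> L" "y \<in> L" "\<not> linked S L x y" using separable_not_linked[OF sep] by metis
    have "y \<in> {y. linked S L x y}"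
    proof (rule linked_invariant[OF linked[OF xy(1,2)]])
      show "x \<in> {y. linked S L x y}" using linked_refl[OF xy(1)] by simp
      fix u v z assume *: "u \<in> {y. linked S L x y}" "u \<in> L" "v \<in> L" "z \<in> L" "triple u v z \<in> ?S"
      then have "triple u v z \<in> S" using n by (auto simp: doubleton_eq_iff)
      from linked_triple[OF this *(2-4)] show "v \<in> {y. linked S L x y}"
        using *(1) linked_trans[of S L x u v] by simp
    qed
    then show False using xy(3) by simp
  qed
  let ?A = "{u. linked S L a u}" and ?B = "{u. linked S L c u}"
  have ac: "a \<in> ?A" "c \<in> ?B" using in_L linked_refl by auto
  have "L \<subseteq> ?A \<union> ?B"
  proof (rule subsetI, rule linked_invariant[OF linked])
    show "a \<in> L" "u \<in> L" if "u \<in> L" for u using in_L that by auto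
    show "a \<in> ?A \<union> ?B" using ac by simp
    fix p q z assume *: "p \<in> ?A \<union> ?B" "p \<in> L" "q \<in> L" "z \<in> L" "triple p q z \<in> ?S"
    show "q \<in> ?A \<union> ?B"
    proof (cases "triple p q z \<in> S")
      case True
      then have "linked S L p q" using * by (intro linked_triple)
      then show ?thesis using *(1) linked_trans[of S L _ p q] by blast
    next
      case False
      \<comment> \<open>The only new edge joins \<open>a\<close> and \<open>c\<close>, so following
        it leads back to the component of \<open>a\<close> or of \<open>c\<close>.\<close>
      then have "q = a \<or> q = c" using *(5) by (auto simp: doubleton_eq_iff)
      then show ?thesis using ac by auto
    qed
  qed
  moreover have "?A \<union> ?B \<subseteq> L" by (auto dest: linked_in)
  ultimately have L: "L = ?A \<union> ?B" by (rule subset_antisym)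
  \<comment> \<open>\<open>b\<close> may lie in either part, so \<open>a\<close> is repeated in its
    place.\<close>
  have "component_split S a a c ?A ?B"
  proof (rule splitI[OF _ ac(1,1,2) L sep])
    show "?A \<union> ?B \<subseteq> leaf_set S" using leafs by (auto dest: linked_leaf_set)
    show "linked S L u v" if "u \<in> ?A" "v \<in> ?A" for u v
      using that linked_trans[OF linked_sym] by simp
    show "linked S L u v" if "u \<in> ?B" "v \<in> ?B" for u v
      using that linked_trans[OF linked_sym] by simp
  qed
  moreover have "b \<in> ?A \<union> ?B" using in_L L by simp
  ultimately show ?thesis by blast
qed

text \<open>
  If \<open>b\<close> lies with \<open>c\<close> in the first pair and \<open>a\<close> lies with \<open>c\<close> in the second, then the union
  of both pairs induces a connected Ahograph.
\<close>

lemma split_of_two_not_aho_separable: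
  assumes aho: "aho_separable S" and leafs: "a \<in> leaf_set S" "b \<in> leaf_set S" "c \<in> leaf_set S"
    and "a \<noteq> b"
    and n1: "\<not> aho_separable (insert (triple a c b) S)"
    and n2: "\<not> aho_separable (insert (triple b c a) S)"
  shows "\<exists>A B. component_split S a b c A B"
proof (rule ccontr)
  assume no: "\<nexists>A B. component_split S a b c A B"
  obtain A B where AB: "component_split S a a c A B" "b \<in> A \<union> B"
    using not_aho_separable_insert[OF aho leafs(1,3) n1] by blast
  obtain A' B' where AB': "component_split S b b c A' B'" "a \<in> A' \<union> B'"
    using not_aho_separable_insert[OF aho leafs(2,3) n2] by blast
  \<comment> \<open>In either of these two cases the pair at hand would already be a split for
    \<open>ab|c\<close>.\<close>
  have "b \<in> A \<Longrightarrow> component_split S a b c A B" "a \<in> A' \<Longrightarrow> component_split S a b c A' B'"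
    using AB(1) AB'(1) unfolding component_split_def by simp_all
  then have "b \<notin> A" "a \<notin> A'" using no by auto
  then have b: "b \<in> B" and a: "a \<in> B'" using AB(2) AB'(2) by auto
  let ?L = "A \<union> B \<union> (A' \<union> B')"
  note s = splitD[OF AB(1)] and s' = splitD[OF AB'(1)]
  have l: "linked S ?L u v" if "linked S (A \<union> B) u v \<or> linked S (A' \<union> B') u v" for u v
    using that linked_mono[of S _ u v S ?L] by blast
  have bc: "linked S ?L b c" using l s(9)[OF b s(7)] by blast
  have ac: "linked S ?L a c" using l s'(9)[OF a s'(7)] by blast
  have c: "linked S ?L u c" if u: "u \<in> ?L" for u
  proof -
    consider "u \<in> A" | "u \<in> B" | "u \<in> A'" | "u \<in> B'" using u by blast
    then show ?thesis
    proof cases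
      case 1 then show ?thesis using l s(8)[OF _ s(5)] linked_trans[OF _ ac] by blast
    next
      case 2 then show ?thesis using l s(9)[OF _ s(7)] by blast
    next
      case 3 then show ?thesis using l s'(8)[OF _ s'(5)] linked_trans[OF _ bc] by blast
    next
      case 4 then show ?thesis using l s'(9)[OF _ s'(7)] by blast
    qed
  qed
  have "linked S ?L u v" if "u \<in> ?L" "v \<in> ?L" for u v
    using linked_trans[OF c[OF that(1)] linked_sym[OF c[OF that(2)]]] .
  moreover have "separable S ?L" by (rule split_separable[OF aho AB(1)]) simp
  ultimately show False unfolding separable_iff by blast
qed

lemma displayed_triples_distinct:
  assumes rt: "rooted_tree_on X T r" and t: "triple a b c \<in> displayed_triples T r"
  shows "distinct [a, b, c]" "a \<in> X" "b \<in> X" "c \<in> X"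
proof -
  have "displays T r (Inl a) (Inl b) (Inl c)"
    by (rule displayed_triplesD[OF _ t]) (use rt in \<open>simp add: rooted_tree_on_def\<close>)
  then show "distinct [a, b, c]" "a \<in> X" "b \<in> X" "c \<in> X"
    using rt unfolding displays_def rooted_tree_on_def by auto
qed

text \<open>The two triples together connect the Ahograph on \<open>{a, b, c}\<close> through
  \<open>a\<close>, against Aho's criterion for a tree.\<close>

lemma displayed_triples_exclusive:
  assumes rt: "rooted_tree T r" and t: "triple a b c \<in> displayed_triples T r"
    "triple a c b \<in> displayed_triples T r" and "a \<noteq> b"
  shows False
proof -
  let ?L = "{a, b, c}" and ?S = "displayed_triples T r"
  have "linked ?S ?L a b" "linked ?S ?L a c"
    using t by (auto intro: linked_triple)
  moreover have "linked ?S ?L a a" by (simp add: linked_refl)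
  ultimately have a: "linked ?S ?L a u" if "u \<in> ?L" for u using that by auto
  have "linked ?S ?L u v" if "u \<in> ?L" "v \<in> ?L" for u v
    using linked_trans[OF linked_sym[OF a[OF that(1)]] a[OF that(2)]] .
  moreover have "separable ?S ?L"
    by (rule aho_separableD[OF aho_separable_displayed_triples[OF rt] _ _ \<open>a \<noteq> b\<close>]) simp_all
  ultimately show False unfolding separable_iff by blast
qed

text \<open>If \<open>ac|b\<close> or \<open>bc|a\<close> could be added, a tree for the larger set
  would also display \<open>ab|c\<close>, as this lies in the closure. Hence neither can, and
  \<open>split_of_two_not_aho_separable\<close> applies.\<close>

lemma cl_component_split:
  assumes aho: "aho_separable S" and tr: "triple_set S" and fin: "finite (leaf_set S)"
    and abc: "triple a b c \<in> cl S"
  shows "\<exists>A B. component_split S a b c A B" "a \<noteq> b"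
proof -
  \<comment> \<open>One tree displaying \<open>S\<close> is needed so that the intersection in
    \<open>cl S\<close> does not run over an empty family; it makes \<open>a\<close>,
    \<open>b\<close>, \<open>c\<close> distinct leaves of \<open>S\<close>.\<close>
  obtain T0 r0 where T0: "rooted_tree_on (leaf_set S) T0 r0" "S \<subseteq> displayed_triples T0 r0"
    using aho_separable_tree[OF aho tr fin] by blast
  have disp: "triple a b c \<in> displayed_triples T r"
    if "rooted_tree_on (leaf_set S) T r" "S \<subseteq> displayed_triples T r" for T r
    using abc that unfolding cl_def by blast
  note d = displayed_triples_distinct[OF T0(1) disp[OF T0]]
  show "a \<noteq> b" using d(1) by simp
  have n: "\<not> aho_separable (insert (triple x c y) S)"
    if xy: "{x, y} = {a, b}" "x \<noteq> y" for x y
  proof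
    let ?S = "insert (triple x c y) S"
    assume aho': "aho_separable ?S"
    have "x \<in> leaf_set S" "y \<in> leaf_set S" "distinct [x, c, y]"
      using d xy by (auto simp: doubleton_eq_iff)
    \<comment> \<open>The leaf set does not grow, so a tree for the larger set is among those
      defining \<open>cl S\<close>.\<close>
    then have "leaf_set ?S = leaf_set S" "triple_set ?S"
      using tr d(4) unfolding leaf_set_def triple_set_def by auto
    then obtain T r where T: "rooted_tree_on (leaf_set S) T r" "?S \<subseteq> displayed_triples T r"
      using aho_separable_tree[OF aho'] fin by auto
    have "triple x y c \<in> displayed_triples T r" using disp[OF T(1)] T(2) xy(1) by simp
    moreover have "triple x c y \<in> displayed_triples T r" using T(2) by simp
    moreover have "rooted_tree T r" using T(1) unfolding rooted_tree_on_def by simp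
    ultimately show False using displayed_triples_exclusive xy(2) by metis
  qed
  show "\<exists>A B. component_split S a b c A B"
    by (rule split_of_two_not_aho_separable[OF aho d(2-4) \<open>a \<noteq> b\<close> n n])
      (use \<open>a \<noteq> b\<close> in auto)
qed

section \<open>Comparing a consistent set with a subset of equal closure\<close>

lemma consistentD:
  assumes "consistent S"
  shows "aho_separable S" "finite (leaf_set S)"
proof -
  obtain X T r where T: "rooted_tree_on X T r" "S \<subseteq> displayed_triples T r"
    using assms unfolding consistent_def by blast
  have rt: "rooted_tree T r" "leaves T = Inl ` X" using T(1) unfolding rooted_tree_on_def by auto
  show "aho_separable S"
    using aho_separable_antimono[OF aho_separable_displayed_triples[OF rt(1)] T(2)] .
  interpret pair_graph T using rt(1) unfolding rooted_tree_def undirected_tree_def by blast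
  have "finite (leaves T)" using pair_finite_verts unfolding leaves_def by simp
  then have "finite X" unfolding rt(2) by (rule finite_imageD) simp
  moreover have "leaf_set S \<subseteq> X"
  proof -
    have "insert c p \<subseteq> X" if t: "(p, c) \<in> S" for p c
    proof -
      obtain a b c' where abc: "(p, c) = triple a b c'" using t T(2) unfolding displayed_triples_def by blast
      then have "triple a b c' \<in> displayed_triples T r" using t T(2) by auto
      from displayed_triples_distinct[OF T(1) this] show ?thesis using abc by simp
    qed
    then show ?thesis by (rule leaf_set_least)
  qed
  ultimately show "finite (leaf_set S)" by (rule finite_subset[rotated])
qed

theorem mainTheorem9:
  fixes R R' :: "'a triple set"
  assumes "triple_set R" and "consistent R"
    and "R' \<subseteq> R" and "cl R' = cl R"
  shows "max_pairs R R = max_pairs R' R' \<and>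
    (\<forall>a b c. triple a b c \<in> cl R \<longrightarrow> max_pair (triple a b c) R' = max_pair (triple a b c) R)"
proof -
  note R = consistentD[OF assms(2)]
  have aho': "aho_separable R'" using aho_separable_antimono[OF R(1) assms(3)] .
  have fin': "finite (leaf_set R')" using leaf_set_mono[OF assms(3)] R(2) by (rule finite_subset)
  have tr': "triple_set R'" using assms(1,3) unfolding triple_set_def by simp
  have "R \<subseteq> cl R" unfolding cl_def by blast
  have split: "\<exists>A B. component_split R' a b c A B" "a \<noteq> b" if "triple a b c \<in> cl R" for a b c
    using cl_component_split[OF aho' tr' fin'] that unfolding assms(4) by blast+
  have cover: "\<exists>A B. component_split R' a b c A B" if "triple a b c \<in> R" for a b c
    using split(1) \<open>R \<subseteq> cl R\<close> that by blast
  have leaf: "leaf_set R = leaf_set R'"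
  proof
    have "insert c p \<subseteq> leaf_set R'" if t: "(p, c) \<in> R" for p c
    proof -
      obtain a b where p: "p = {a, b}" using t assms(1) unfolding triple_set_def by blast
      \<comment> \<open>Each triple of \<open>R\<close> has a split for \<open>R'\<close>, and the
        parts of such a split consist of leaves of \<open>R'\<close>.\<close>
      obtain A B where "component_split R' a b c A B" using cover t p by blast
      from splitD(1,2,5-7)[OF this] show ?thesis using p by auto
    qed
    then show "leaf_set R \<subseteq> leaf_set R'" by (rule leaf_set_least)
  qed (rule leaf_set_mono[OF assms(3)])
  have ne: "component_pairs (triple a b c) R' \<noteq> {}" if t: "triple a b c \<in> cl R" for a b c
    using split(1)[OF t] unfolding component_pairs_eq by blast
  have eq: "max_pair (triple a b c) R' = max_pair (triple a b c) R" if "triple a b c \<in> cl R" for a b c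
    by (rule max_pair_transfer[OF R(1) assms(3) R(2) cover leaf ne[OF that]])
  have in_cl: "t \<in> cl R" if "t \<in> R" for t using \<open>R \<subseteq> cl R\<close> that by blast
  \<comment> \<open>The maximal pair of \<open>t\<close> is the same for \<open>R'\<close> by
    \<open>eq\<close>, and \<open>max_pair_crossing\<close> finds a triple of \<open>R'\<close> with
    that pair.\<close>
  have "\<exists>t'\<in>R'. max_pair t R = max_pair t' R'" if t: "t \<in> R" for t
  proof -
    obtain a b c where abc: "t = triple a b c" using t assms(1) unfolding triple_set_def by blast
    have c: "triple a b c \<in> cl R" using in_cl[OF t] unfolding abc .
    obtain x y z where "triple x y z \<in> R'" "max_pair (triple x y z) R' = max_pair (triple a b c) R'"
      using max_pair_crossing[OF aho' fin' split(2)[OF c] ne[OF c]] by blast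
    then show ?thesis using eq[OF c] unfolding abc by metis
  qed
  moreover have "max_pair t R' = max_pair t R" if t: "t \<in> R'" for t
  proof -
    obtain a b c where "t = triple a b c" using t tr' unfolding triple_set_def by blast
    then show ?thesis using eq in_cl t assms(3) by blast
  qed
  ultimately have "max_pairs R R = max_pairs R' R'"
    using assms(3) unfolding max_pairs_def by blast
  then show ?thesis using eq by blast
qed

end
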